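(* The class of strongly separable extensions is Morita invariant: if $A/B$ is strongly separable and $A/B$ is Morita equivalent to $A'/B'$, then $A'/B'$ is strongly separable.
   Context: All rings have identity, subrings contain the identity, modules are unital; a ring extension $A/B$ means $B$ is a subring of $A$. Let $V=V_A(B)=\{a\in A\mid ba=ab\ \forall b\in B\}$ and $C=V_A(A)$ the center of $A$. $\mathrm{Hom}^\ell(V_C,A_C)$ denotes right $C$-homomorphisms $V\to A$ (an $A$-$A$-bimodule via $(xfy)(v)=xf(v)y$). $A/B$ is strongly separable if $V$ is finitely generated projective as a $C$-module and the $A$-$A$-homomorphism $A\otimes_BA\to\mathrm{Hom}^\ell(V_C,A_C)$, $x\otimes y\mapsto[v\mapsto xvy]$, splits (as an $A$-$A$-bimodule map). For bimodules ${}_AX_{A'}$, ${}_AY_{A'}$, write $X\mid Y$ if $X$ is isomorphic to a direct summand of a finite direct sum of copies of $Y$, and $X\sim Y$ if $X\mid Y$ and $Y\mid X$. $\mathrm{End}^r({}_AM)$ denotes the ring of left $A$-endomorphisms of $M$ acting on the right. A bimodule ${}_AM_{A'}$ is a Morita module if ${}_AM\sim{}_AA$ and $\mathrm{End}^r({}_AM)=A'$. Ring extensions $A/B$ and $A'/B'$ are Morita equivalent if there exist Morita modules ${}_AM_{A'}$ and ${}_BN_{B'}$ with ${}_AA\otimes_BN_{B'}\cong{}_AM_{B'}$. A class $\mathscr C$ is Morita invariant if whenever $A/B\in\mathscr C$ and $A/B$ is Morita equivalent to $A'/B'$, then $A'/B'\in\mathscr C$. *)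

theory Defs
  imports Main
begin

text \<open>Conventions. A ring A is modelled as a whole type of class ring_1; a subring B is a
subset of it. Modules are subsets (additive subgroups) of a type of class ab_group_add,
with explicit action functions. Tensor products over B are built concretely as
finitely supported integer formal sums modulo the usual relation subgroup.\<close>

definition subring :: "'a::ring_1 set \<Rightarrow> bool" where
  "subring B \<longleftrightarrow> 1 \<in> B \<and> (\<forall>x\<in>B. \<forall>y\<in>B. x - y \<in> B \<and> x * y \<in> B)"

definition centralizer :: "'a::ring_1 set \<Rightarrow> 'a set" where
  "centralizer B = {a. \<forall>b\<in>B. b * a = a * b}"

definition free_mod :: "'a::zero set \<Rightarrow> nat \<Rightarrow> (nat \<Rightarrow> 'a) set" where
  "free_mod Y n = {c. (\<forall>i<n. c i \<in> Y) \<and> (\<forall>i\<ge>n. c i = 0)}"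

definition fgp_right :: "'a::ring_1 set \<Rightarrow> 'a set \<Rightarrow> bool" where
  "fgp_right C V \<longleftrightarrow> (\<exists>n p q.
     (\<forall>v\<in>V. p v \<in> free_mod C n) \<and> (\<forall>c\<in>free_mod C n. q c \<in> V)
   \<and> (\<forall>v\<in>V. \<forall>w\<in>V. p (v + w) = (\<lambda>i. p v i + p w i))
   \<and> (\<forall>v\<in>V. \<forall>c\<in>C. p (v * c) = (\<lambda>i. p v i * c))
   \<and> (\<forall>x\<in>free_mod C n. \<forall>y\<in>free_mod C n. q (\<lambda>i. x i + y i) = q x + q y)
   \<and> (\<forall>x\<in>free_mod C n. \<forall>c\<in>C. q (\<lambda>i. x i * c) = q x * c)
   \<and> (\<forall>v\<in>V. q (p v) = v))"

definition hom_right :: "'a::ring_1 set \<Rightarrow> 'a set \<Rightarrow> ('a \<Rightarrow> 'a) set" where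
  "hom_right C V = {h. (\<forall>v. v \<notin> V \<longrightarrow> h v = 0)
     \<and> (\<forall>v\<in>V. \<forall>w\<in>V. h (v + w) = h v + h w)
     \<and> (\<forall>v\<in>V. \<forall>c\<in>C. h (v * c) = h v * c)}"

definition fsupp :: "('p \<Rightarrow> int) \<Rightarrow> 'p set" where
  "fsupp \<phi> = {p. \<phi> p \<noteq> 0}"

definition fsums :: "'x set \<Rightarrow> 'y set \<Rightarrow> ('x \<times> 'y \<Rightarrow> int) set" where
  "fsums X Y = {\<phi>. finite (fsupp \<phi>) \<and> fsupp \<phi> \<subseteq> X \<times> Y}"

definition fgen :: "'x \<Rightarrow> 'y \<Rightarrow> ('x \<times> 'y \<Rightarrow> int)" where
  "fgen x y = (\<lambda>p. if p = (x, y) then 1 else 0)"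

definition fmap :: "('p \<Rightarrow> 'q) \<Rightarrow> ('p \<Rightarrow> int) \<Rightarrow> ('q \<Rightarrow> int)" where
  "fmap f \<phi> = (\<lambda>q. \<Sum>p\<in>{p\<in>fsupp \<phi>. f p = q}. \<phi> p)"

inductive_set tens_rel :: "'x::ab_group_add set \<Rightarrow> 'y::ab_group_add set \<Rightarrow> 'r set
    \<Rightarrow> ('x \<Rightarrow> 'r \<Rightarrow> 'x) \<Rightarrow> ('r \<Rightarrow> 'y \<Rightarrow> 'y) \<Rightarrow> ('x \<times> 'y \<Rightarrow> int) set"
  for X Y R rx ly where
  zero: "(\<lambda>_. 0) \<in> tens_rel X Y R rx ly"
| diff: "\<phi> \<in> tens_rel X Y R rx ly \<Longrightarrow> \<psi> \<in> tens_rel X Y R rx ly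
         \<Longrightarrow> (\<lambda>p. \<phi> p - \<psi> p) \<in> tens_rel X Y R rx ly"
| addl: "x \<in> X \<Longrightarrow> x' \<in> X \<Longrightarrow> y \<in> Y
         \<Longrightarrow> (\<lambda>p. fgen (x + x') y p - fgen x y p - fgen x' y p) \<in> tens_rel X Y R rx ly"
| addr: "x \<in> X \<Longrightarrow> y \<in> Y \<Longrightarrow> y' \<in> Y
         \<Longrightarrow> (\<lambda>p. fgen x (y + y') p - fgen x y p - fgen x y' p) \<in> tens_rel X Y R rx ly"
| bal: "x \<in> X \<Longrightarrow> r \<in> R \<Longrightarrow> y \<in> Y
         \<Longrightarrow> (\<lambda>p. fgen (rx x r) y p - fgen x (ly r y) p) \<in> tens_rel X Y R rx ly"

text \<open>The map A \<otimes>_B A \<rightarrow> Hom^l(V_C, A_C), x \<otimes> y \<mapsto> [v \<mapsto> x v y], on formal sums.\<close>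
definition mu_map :: "'a::ring_1 set \<Rightarrow> ('a \<times> 'a \<Rightarrow> int) \<Rightarrow> ('a \<Rightarrow> 'a)" where
  "mu_map V \<phi> = (\<lambda>v. if v \<in> V then (\<Sum>p\<in>fsupp \<phi>. of_int (\<phi> p) * fst p * v * snd p) else 0)"

text \<open>A/B strongly separable (A = the whole type): V f.g. projective over C and the
A-A-bimodule map A \<otimes>_B A \<rightarrow> Hom^l(V_C,A_C) has an A-A-bimodule section s
(given on representatives, i.e. a map into formal sums which is additive and
bilinear modulo the tensor relations).\<close>
definition strongly_separable :: "'a::ring_1 set \<Rightarrow> bool" where
  "strongly_separable B \<longleftrightarrow>
    (let V = centralizer B; C = centralizer (UNIV :: 'a set); H = hom_right C V;
         R = tens_rel (UNIV :: 'a set) (UNIV :: 'a set) B (*) (*)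
     in fgp_right C V \<and>
        (\<exists>s. (\<forall>h\<in>H. s h \<in> fsums (UNIV :: 'a set) (UNIV :: 'a set))
           \<and> (\<forall>h\<in>H. \<forall>g\<in>H. (\<lambda>p. s (\<lambda>v. h v + g v) p - s h p - s g p) \<in> R)
           \<and> (\<forall>h\<in>H. \<forall>x y. (\<lambda>p. s (\<lambda>v. x * h v * y) p
                               - fmap (\<lambda>(a, b). (x * a, b * y)) (s h) p) \<in> R)
           \<and> (\<forall>h\<in>H. mu_map V (s h) = h)))"

definition bimod :: "'r::ring_1 set \<Rightarrow> 's::ring_1 set \<Rightarrow> 'm::ab_group_add set
    \<Rightarrow> ('r \<Rightarrow> 'm \<Rightarrow> 'm) \<Rightarrow> ('m \<Rightarrow> 's \<Rightarrow> 'm) \<Rightarrow> bool" where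
  "bimod R S X l r \<longleftrightarrow> 0 \<in> X \<and> (\<forall>x\<in>X. \<forall>y\<in>X. x - y \<in> X)
   \<and> (\<forall>a\<in>R. \<forall>x\<in>X. l a x \<in> X) \<and> (\<forall>s\<in>S. \<forall>x\<in>X. r x s \<in> X)
   \<and> (\<forall>a\<in>R. \<forall>x\<in>X. \<forall>y\<in>X. l a (x + y) = l a x + l a y)
   \<and> (\<forall>a\<in>R. \<forall>b\<in>R. \<forall>x\<in>X. l (a + b) x = l a x + l b x)
   \<and> (\<forall>a\<in>R. \<forall>b\<in>R. \<forall>x\<in>X. l (a * b) x = l a (l b x))
   \<and> (\<forall>x\<in>X. l 1 x = x)
   \<and> (\<forall>s\<in>S. \<forall>x\<in>X. \<forall>y\<in>X. r (x + y) s = r x s + r y s)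
   \<and> (\<forall>s\<in>S. \<forall>t\<in>S. \<forall>x\<in>X. r x (s + t) = r x s + r x t)
   \<and> (\<forall>s\<in>S. \<forall>t\<in>S. \<forall>x\<in>X. r x (s * t) = r (r x s) t)
   \<and> (\<forall>x\<in>X. r x 1 = x)
   \<and> (\<forall>a\<in>R. \<forall>s\<in>S. \<forall>x\<in>X. r (l a x) s = l a (r x s))"

definition lmod_dvd :: "'r set \<Rightarrow> 'x::ab_group_add set \<Rightarrow> ('r \<Rightarrow> 'x \<Rightarrow> 'x)
    \<Rightarrow> 'y::ab_group_add set \<Rightarrow> ('r \<Rightarrow> 'y \<Rightarrow> 'y) \<Rightarrow> bool" where
  "lmod_dvd R X lx Y ly \<longleftrightarrow> (\<exists>n f g.
     (\<forall>x\<in>X. f x \<in> free_mod Y n) \<and> (\<forall>c\<in>free_mod Y n. g c \<in> X)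
   \<and> (\<forall>x\<in>X. \<forall>x'\<in>X. f (x + x') = (\<lambda>i. f x i + f x' i))
   \<and> (\<forall>a\<in>R. \<forall>x\<in>X. f (lx a x) = (\<lambda>i. ly a (f x i)))
   \<and> (\<forall>c\<in>free_mod Y n. \<forall>d\<in>free_mod Y n. g (\<lambda>i. c i + d i) = g c + g d)
   \<and> (\<forall>a\<in>R. \<forall>c\<in>free_mod Y n. g (\<lambda>i. ly a (c i)) = lx a (g c))
   \<and> (\<forall>x\<in>X. g (f x) = x))"

definition morita_module :: "'r::ring_1 set \<Rightarrow> 's::ring_1 set \<Rightarrow> 'm::ab_group_add set
    \<Rightarrow> ('r \<Rightarrow> 'm \<Rightarrow> 'm) \<Rightarrow> ('m \<Rightarrow> 's \<Rightarrow> 'm) \<Rightarrow> bool" where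
  "morita_module R S X l r \<longleftrightarrow> bimod R S X l r
   \<and> lmod_dvd R X l R (*) \<and> lmod_dvd R R (*) X l
   \<and> (\<forall>\<phi>. ((\<forall>x\<in>X. \<phi> x \<in> X) \<and> (\<forall>x\<in>X. \<forall>y\<in>X. \<phi> (x + y) = \<phi> x + \<phi> y)
            \<and> (\<forall>a\<in>R. \<forall>x\<in>X. \<phi> (l a x) = l a (\<phi> x)))
        \<longrightarrow> (\<exists>!s. s \<in> S \<and> (\<forall>x\<in>X. \<phi> x = r x s)))"

text \<open>A/B and A'/B' Morita equivalent via _A M_{A'} and _B N_{B'}, with
_A (A \<otimes>_B N)_{B'} \<cong> _A M_{B'} (an isomorphism theta from the concrete tensor product,
given on representatives, with inverse psi).\<close>
definition morita_equiv_via :: "'a::ring_1 set \<Rightarrow> 'b::ring_1 set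
    \<Rightarrow> 'm::ab_group_add set \<Rightarrow> ('a \<Rightarrow> 'm \<Rightarrow> 'm) \<Rightarrow> ('m \<Rightarrow> 'b \<Rightarrow> 'm)
    \<Rightarrow> 'n::ab_group_add set \<Rightarrow> ('a \<Rightarrow> 'n \<Rightarrow> 'n) \<Rightarrow> ('n \<Rightarrow> 'b \<Rightarrow> 'n) \<Rightarrow> bool" where
  "morita_equiv_via B B' M lm rm N ln rn \<longleftrightarrow>
     morita_module (UNIV :: 'a set) (UNIV :: 'b set) M lm rm
   \<and> morita_module B B' N ln rn
   \<and> (let F = fsums (UNIV :: 'a set) N; Rl = tens_rel (UNIV :: 'a set) N B (*) ln in
      \<exists>\<theta> \<psi>. (\<forall>\<phi>\<in>F. \<theta> \<phi> \<in> M)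
        \<and> (\<forall>\<phi>\<in>F. \<forall>\<phi>'\<in>F. \<theta> (\<lambda>p. \<phi> p + \<phi>' p) = \<theta> \<phi> + \<theta> \<phi>')
        \<and> (\<forall>\<rho>\<in>Rl. \<theta> \<rho> = 0)
        \<and> (\<forall>a. \<forall>\<phi>\<in>F. \<theta> (fmap (\<lambda>(x, y). (a * x, y)) \<phi>) = lm a (\<theta> \<phi>))
        \<and> (\<forall>b\<in>B'. \<forall>\<phi>\<in>F. \<theta> (fmap (\<lambda>(x, y). (x, rn y b)) \<phi>) = rm (\<theta> \<phi>) b)
        \<and> (\<forall>m\<in>M. \<psi> m \<in> F \<and> \<theta> (\<psi> m) = m)
        \<and> (\<forall>\<phi>\<in>F. (\<lambda>p. \<psi> (\<theta> \<phi>) p - \<phi> p) \<in> Rl))"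

end

(* Strong separability of A/B means that there are finitely many v_i in V and Casimir elements
   e_i of A (x)_B A (those with a e = e a for all a in A) such that w is the sum of the
   v_i mu(e_i)(w) for every w in V: the maps mu(e_i) : V -> C are the coordinates of a dual basis,
   and h |-> sum of the h(v_i) e_i is the section.

   In a Morita equivalence A' (x)_B' A' = M* (x)_A (A (x)_B A) (x)_A M, so a Casimir element e of
   A (x)_B A yields the Casimir element of A' (x)_B' A' given by the sum of the f_j (x) e (x) n_j,
   for a dual basis (f_j, n_j) of M.  As endomorphisms of M = A (x)_B N, the elements of the
   centralizers V and V' correspond, a (x) n |-> a v (x) n, and this bijection carries the
   identity for the v_i, e_i over to A'/B'. *)

theory Submission
  imports Defs "HOL-Library.Function_Algebras"
begin

section \<open>Evaluation of formal sums\<close>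

text \<open>\<open>A\<close> and \<open>A'\<close> meet only through bimodules, so neither the
  bimodule of C-homomorphisms V -> A nor its splitting can be moved from one ring to the other
  directly; finitely many elements can, by calculations with representatives.

  The bijection of V and V' is visible only on the image I of N in M. There w in V' acts as the
  corresponding v in V, but on all of M right multiplication by w is a \<otimes> n \<mapsto> a v
  \<otimes> n, in general not left multiplication by v. For this reason the dual basis of M, and the
  elements showing that M is a generator, are taken from N: elements of I then have coordinates in
  B, which commute with V, and identities in \<open>A'\<close> are tested on I.

  A map from a tensor product over B to one over \<open>B'\<close> also needs something to put in
  the middle. It comes from writing 1 as a sum of values G_k(m_k), with N a generator; balancing
  over B becomes balancing over \<open>B'\<close> because every B-endomorphism of N is right
  multiplication by an element of \<open>B'\<close>.\<close>

definition add_subgroup :: "'a::ab_group_add set \<Rightarrow> bool" where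
  "add_subgroup S \<longleftrightarrow> 0 \<in> S \<and> (\<forall>x\<in>S. \<forall>y\<in>S. x - y \<in> S)"

lemma add_subgroup_zero: "add_subgroup S \<Longrightarrow> 0 \<in> S"
  by (simp add: add_subgroup_def)

lemma add_subgroup_diff: "add_subgroup S \<Longrightarrow> x \<in> S \<Longrightarrow> y \<in> S \<Longrightarrow> x - y \<in> S"
  by (simp add: add_subgroup_def)

lemma add_subgroup_add:
  assumes "add_subgroup S" "x \<in> S" "y \<in> S"
  shows "x + y \<in> S"
proof -
  have "x - (0 - y) \<in> S"
    using assms by (intro add_subgroup_diff add_subgroup_zero)
  then show ?thesis by simp
qed

lemma add_subgroup_sum:
  assumes "add_subgroup S" "\<And>i. i \<in> I \<Longrightarrow> f i \<in> S"
  shows "sum f I \<in> S"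
  using assms(2)
  by (induction I rule: infinite_finite_induct)
     (auto intro: add_subgroup_zero add_subgroup_add assms(1))

lemma add_subgroup_of_int_mult:
  fixes x :: "'a::ring_1"
  assumes S: "add_subgroup S" and x: "x \<in> S"
  shows "of_int n * x \<in> S"
proof (induction n rule: int_induct[where k=0])
  case base
  show ?case using S by (simp add: add_subgroup_zero)
next
  case (step1 i)
  then show ?case using add_subgroup_add[OF S _ x, of "of_int i * x"] by (simp add: algebra_simps)
next
  case (step2 i)
  then show ?case using add_subgroup_diff[OF S _ x, of "of_int i * x"] by (simp add: algebra_simps)
qed

lemma add_subgroup_sum_cong:
  assumes "add_subgroup S" "\<And>i. i \<in> I \<Longrightarrow> f i - g i \<in> S"
  shows "sum f I - sum g I \<in> S"
  using add_subgroup_sum[OF assms] by (simp add: sum_subtractf)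

lemma add_subgroup_trans:
  assumes "add_subgroup S" "x - y \<in> S" "y - z \<in> S"
  shows "x - z \<in> S"
  using add_subgroup_add[OF assms] by simp

lemma add_subgroup_sym:
  assumes "add_subgroup S" "x - y \<in> S"
  shows "y - x \<in> S"
  using add_subgroup_diff[OF assms(1) add_subgroup_zero[OF assms(1)] assms(2)] by simp

lemma additive_sum:
  assumes S: "add_subgroup S" and f: "\<And>x y. x \<in> S \<Longrightarrow> y \<in> S \<Longrightarrow> f (x + y) = f x + f y"
    and g: "\<And>i. i \<in> I \<Longrightarrow> g i \<in> S"
  shows "f (sum g I) = (\<Sum>i\<in>I. f (g i) :: 'b::ab_group_add)"
proof -
  have f0: "f 0 = 0"
    using f[OF add_subgroup_zero[OF S] add_subgroup_zero[OF S]] by simp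
  show ?thesis
    using g
  proof (induction I rule: infinite_finite_induct)
    case (insert i I)
    then have "f (g i + sum g I) = f (g i) + f (sum g I)"
      by (intro f add_subgroup_sum S) auto
    with insert show ?case by simp
  qed (simp_all add: f0)
qed

lemma additive_diff:
  assumes S: "add_subgroup S" and f: "\<And>x y. x \<in> S \<Longrightarrow> y \<in> S \<Longrightarrow> f (x + y) = f x + f y"
    and "x \<in> S" "y \<in> S"
  shows "f (x - y) = f x - (f y :: 'b::ab_group_add)"
  using f[of "x - y" y] assms(3,4) add_subgroup_diff[OF S] by simp

lemma sum_fun_apply: "(\<Sum>i\<in>I. f i) x = (\<Sum>i\<in>I. f i x)"
  by (induction I rule: infinite_finite_induct) simp_all

lemma of_int_fun_apply: "(of_int n :: 'a \<Rightarrow> 'b::ring_1) x = of_int n"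
  by (cases n) simp_all

text \<open>Additive extension of \<open>g\<close> to formal sums. The codomain may itself consist
  of formal sums: pointwise operations make integer-valued functions a ring in which
  \<open>of_int k\<close> is the constant function k. One definition thus serves maps into rings and
  maps into tensor products.\<close>

definition fev :: "('p \<Rightarrow> 'r::ring_1) \<Rightarrow> ('p \<Rightarrow> int) \<Rightarrow> 'r" where
  "fev g \<phi> = (\<Sum>p\<in>fsupp \<phi>. of_int (\<phi> p) * g p)"

abbreviation fin_sums :: "('x \<times> 'y \<Rightarrow> int) set" where
  "fin_sums \<equiv> fsums UNIV UNIV"

lemma fin_sums_iff: "\<phi> \<in> fin_sums \<longleftrightarrow> finite (fsupp \<phi>)"
  by (simp add: fsums_def)

lemma fsums_fin_sums: "\<phi> \<in> fsums X Y \<Longrightarrow> \<phi> \<in> fin_sums"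
  by (simp add: fsums_def)

lemma fev_superset:
  assumes "finite S" "fsupp \<phi> \<subseteq> S"
  shows "fev g \<phi> = (\<Sum>p\<in>S. of_int (\<phi> p) * g p)"
  unfolding fev_def using assms by (intro sum.mono_neutral_left) (auto simp: fsupp_def)

lemma add_subgroup_fsums: "add_subgroup (fsums X Y)"
  unfolding add_subgroup_def
proof (intro conjI ballI)
  show "0 \<in> fsums X Y" by (simp add: fsums_def fsupp_def)
next
  fix \<phi> \<psi> assume *: "\<phi> \<in> fsums X Y" "\<psi> \<in> fsums X Y"
  have sub: "fsupp (\<phi> - \<psi>) \<subseteq> fsupp \<phi> \<union> fsupp \<psi>"
    by (auto simp: fsupp_def)
  have "finite (fsupp \<phi> \<union> fsupp \<psi>)" "fsupp \<phi> \<union> fsupp \<psi> \<subseteq> X \<times> Y"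
    using * by (auto simp: fsums_def)
  with sub show "\<phi> - \<psi> \<in> fsums X Y"
    unfolding fsums_def by (auto intro: finite_subset)
qed

lemma fsupp_fgen: "fsupp (fgen x y) = {(x, y)}"
  by (auto simp: fsupp_def fgen_def)

lemma fgen_fsums: "x \<in> X \<Longrightarrow> y \<in> Y \<Longrightarrow> fgen x y \<in> fsums X Y"
  by (simp add: fsums_def fsupp_fgen)

lemma fev_fgen [simp]: "fev g (fgen x y) = g (x, y)"
  by (simp add: fev_def fsupp_fgen) (simp add: fgen_def)

lemma fev_add:
  assumes "\<phi> \<in> fin_sums" "\<psi> \<in> fin_sums"
  shows "fev g (\<phi> + \<psi>) = fev g \<phi> + fev g \<psi>"
proof -
  let ?S = "fsupp \<phi> \<union> fsupp \<psi>"
  have "finite ?S" "fsupp (\<phi> + \<psi>) \<subseteq> ?S"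
    using assms by (auto simp: fin_sums_iff) (auto simp: fsupp_def)
  then show ?thesis
    by (simp add: fev_superset[of ?S] sum.distrib distrib_right)
qed

lemma fev_diff:
  "\<phi> \<in> fin_sums \<Longrightarrow> \<psi> \<in> fin_sums \<Longrightarrow> fev g (\<phi> - \<psi>) = fev g \<phi> - fev g \<psi>"
  using additive_diff[OF add_subgroup_fsums, of UNIV UNIV "fev g" \<phi> \<psi>] by (simp add: fev_add)

lemma fev_sum:
  "(\<And>i. i \<in> I \<Longrightarrow> \<phi> i \<in> fin_sums) \<Longrightarrow> fev g (\<Sum>i\<in>I. \<phi> i) = (\<Sum>i\<in>I. fev g (\<phi> i))"
  using additive_sum[OF add_subgroup_fsums, of UNIV UNIV "fev g" I \<phi>] by (simp add: fev_add)

lemma fev_zero [simp]: "fev g 0 = 0"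
  by (simp add: fev_def fsupp_def)

lemma fev_of_int_mult: "\<phi> \<in> fin_sums \<Longrightarrow> fev g (of_int n * \<phi>) = of_int n * fev g \<phi>"
  by (subst fev_superset[of "fsupp \<phi>"])
     (auto simp: fin_sums_iff fsupp_def of_int_fun_apply fev_def sum_distrib_left mult.assoc)

lemma fev_fun_sum: "fev (\<lambda>p. \<Sum>i\<in>I. g i p) \<phi> = (\<Sum>i\<in>I. fev (g i) \<phi>)"
  unfolding fev_def sum_distrib_left by (rule sum.swap)

lemma fev_fun_diff: "fev (\<lambda>p. g p - h p) \<phi> = fev g \<phi> - fev h \<phi>"
  by (simp add: fev_def right_diff_distrib sum_subtractf)

lemma fev_mult_left: "fev (\<lambda>p. c * g p) \<phi> = c * fev g \<phi>"
  by (simp add: fev_def sum_distrib_left mult.assoc[symmetric])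
     (simp add: mult_of_int_commute[symmetric])

lemma fev_mult_right: "fev (\<lambda>p. g p * c) \<phi> = fev g \<phi> * c"
  by (simp add: fev_def sum_distrib_right mult.assoc)

lemma fev_mem:
  assumes "add_subgroup S" "\<phi> \<in> fsums X Y" "\<And>x y. x \<in> X \<Longrightarrow> y \<in> Y \<Longrightarrow> g (x, y) \<in> S"
  shows "fev g \<phi> \<in> S"
  unfolding fev_def
  by (intro add_subgroup_sum[OF assms(1)] add_subgroup_of_int_mult[OF assms(1)])
     (use assms(2,3) in \<open>auto simp: fsums_def\<close>)

lemma fev_mem_cong:
  assumes "add_subgroup S" "\<phi> \<in> fsums X Y"
    and "\<And>x y. x \<in> X \<Longrightarrow> y \<in> Y \<Longrightarrow> g (x, y) - h (x, y) \<in> S"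
  shows "fev g \<phi> - fev h \<phi> \<in> S"
  using fev_mem[OF assms(1,2), of "\<lambda>p. g p - h p"] assms(3) by (simp add: fev_fun_diff)

lemma fev_fev:
  assumes "\<And>p. k p \<in> fin_sums"
  shows "fev g (fev k \<phi>) = fev (\<lambda>p. fev g (k p)) \<phi>"
  unfolding fev_def[of k] fev_def[of "\<lambda>p. fev g (k p)"]
  using assms by (simp add: fev_sum fev_of_int_mult add_subgroup_of_int_mult[OF add_subgroup_fsums])

text \<open>Pushforward is the additive extension of the map taking a pair to the generator of its
  image, so the rules for \<open>fmap\<close> reduce to those for \<open>fev\<close>.\<close>

lemma fmap_eq_fev:
  fixes f :: "'x \<times> 'y \<Rightarrow> 'z \<times> 'w"
  assumes "\<phi> \<in> fin_sums"
  shows "fmap f \<phi> = fev (\<lambda>p. fgen (fst (f p)) (snd (f p))) \<phi>"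
proof
  fix q
  have "fmap f \<phi> q = (\<Sum>p\<in>fsupp \<phi>. if f p = q then \<phi> p else 0)"
    using assms unfolding fmap_def fin_sums_iff by (intro sum.inter_filter)
  also have "\<dots> = (\<Sum>p\<in>fsupp \<phi>. (of_int (\<phi> p) * fgen (fst (f p)) (snd (f p))) q)"
    by (intro sum.cong refl) (auto simp: of_int_fun_apply fgen_def)
  also have "\<dots> = fev (\<lambda>p. fgen (fst (f p)) (snd (f p))) \<phi> q"
    unfolding fev_def by (rule sum_fun_apply[symmetric])
  finally show "fmap f \<phi> q = fev (\<lambda>p. fgen (fst (f p)) (snd (f p))) \<phi> q" .
qed

lemma fmap_fsums:
  assumes "\<phi> \<in> fsums X Y" "\<And>x y. x \<in> X \<Longrightarrow> y \<in> Y \<Longrightarrow> f (x, y) \<in> X' \<times> Y'"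
  shows "fmap f \<phi> \<in> fsums X' Y'"
  unfolding fmap_eq_fev[OF fsums_fin_sums[OF assms(1)]]
  by (rule fev_mem[OF add_subgroup_fsums assms(1)])
     (metis assms(2) fgen_fsums mem_Times_iff)

lemma fmap_fin_sums: "\<phi> \<in> fin_sums \<Longrightarrow> fmap f \<phi> \<in> fin_sums"
  by (erule fmap_fsums) simp

lemma fev_fmap:
  fixes f :: "'x \<times> 'y \<Rightarrow> 'z \<times> 'w"
  shows "\<phi> \<in> fin_sums \<Longrightarrow> fev g (fmap f \<phi>) = fev (\<lambda>p. g (f p)) \<phi>"
  by (simp add: fmap_eq_fev fev_fev fgen_fsums)

lemma fmap_fgen:
  fixes f :: "'x \<times> 'y \<Rightarrow> 'z \<times> 'w"
  shows "fmap f (fgen x y) = fgen (fst (f (x, y))) (snd (f (x, y)))"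
  by (simp add: fmap_eq_fev fgen_fsums)

lemma fmap_add:
  fixes f :: "'x \<times> 'y \<Rightarrow> 'z \<times> 'w"
  shows "\<phi> \<in> fin_sums \<Longrightarrow> \<psi> \<in> fin_sums \<Longrightarrow> fmap f (\<phi> + \<psi>) = fmap f \<phi> + fmap f \<psi>"
  by (simp add: fmap_eq_fev fev_add add_subgroup_add[OF add_subgroup_fsums])

lemma fmap_diff:
  fixes f :: "'x \<times> 'y \<Rightarrow> 'z \<times> 'w"
  shows "\<phi> \<in> fin_sums \<Longrightarrow> \<psi> \<in> fin_sums \<Longrightarrow> fmap f (\<phi> - \<psi>) = fmap f \<phi> - fmap f \<psi>"
  using additive_diff[OF add_subgroup_fsums, of UNIV UNIV "fmap f" \<phi> \<psi>] by (simp add: fmap_add)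

lemma fmap_sum:
  fixes f :: "'x \<times> 'y \<Rightarrow> 'z \<times> 'w"
  shows "(\<And>i. i \<in> I \<Longrightarrow> \<phi> i \<in> fin_sums) \<Longrightarrow> fmap f (\<Sum>i\<in>I. \<phi> i) = (\<Sum>i\<in>I. fmap f (\<phi> i))"
  using additive_sum[OF add_subgroup_fsums, of UNIV UNIV "fmap f" I \<phi>] by (simp add: fmap_add)

lemma fmap_fev:
  fixes f :: "'x \<times> 'y \<Rightarrow> 'z \<times> 'w"
  assumes "\<phi> \<in> fin_sums" "\<And>p. k p \<in> fin_sums"
  shows "fmap f (fev k \<phi>) = fev (\<lambda>p. fmap f (k p)) \<phi>"
proof -
  have "fev k \<phi> \<in> fin_sums"
    using assms by (intro fev_mem[OF add_subgroup_fsums]) auto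
  then show ?thesis using assms by (simp add: fmap_eq_fev fev_fev)
qed

lemma fmap_fmap:
  fixes f :: "'x \<times> 'y \<Rightarrow> 'z \<times> 'w" and g :: "'u \<times> 'v \<Rightarrow> 'x \<times> 'y"
  shows "\<phi> \<in> fin_sums \<Longrightarrow> fmap f (fmap g \<phi>) = fmap (\<lambda>p. f (g p)) \<phi>"
  using fev_fmap[of \<phi> "\<lambda>p. fgen (fst (f p)) (snd (f p))" g]
  by (simp add: fmap_eq_fev[of _ f] fmap_eq_fev[of _ "\<lambda>p. f (g p)"] fmap_fin_sums)

text \<open>Formal sums on X \<times> Y form the free abelian group on these pairs. Those satisfying
  \<open>P\<close> are a subgroup containing the generators, and \<open>\<phi>\<close> is its own
  evaluation at the generators.\<close>

lemma fsums_induct [consumes 1, case_names zero gen diff]: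
  assumes "\<phi> \<in> fsums X Y"
    and zero: "P 0"
    and gen: "\<And>x y. x \<in> X \<Longrightarrow> y \<in> Y \<Longrightarrow> P (fgen x y)"
    and diff: "\<And>\<phi> \<psi>. \<phi> \<in> fsums X Y \<Longrightarrow> \<psi> \<in> fsums X Y \<Longrightarrow> P \<phi> \<Longrightarrow> P \<psi> \<Longrightarrow> P (\<phi> - \<psi>)"
  shows "P \<phi>"
proof -
  let ?S = "{\<phi> \<in> fsums X Y. P \<phi>}"
  have "add_subgroup ?S"
    using add_subgroup_fsums[of X Y] zero diff by (auto simp: add_subgroup_def)
  then have "fev (\<lambda>p. fgen (fst p) (snd p)) \<phi> \<in> ?S"
    using assms(1) by (rule fev_mem) (simp add: gen fgen_fsums)
  moreover have "fev (\<lambda>p. fgen (fst p) (snd p)) \<phi> = fmap (\<lambda>p. p) \<phi>"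
    using fsums_fin_sums[OF assms(1)] by (simp add: fmap_eq_fev)
  moreover have "fmap (\<lambda>p. p) \<phi> = \<phi>"
  proof
    fix q
    have "{p \<in> fsupp \<phi>. p = q} = (if \<phi> q = 0 then {} else {q})"
      by (auto simp: fsupp_def)
    then show "fmap (\<lambda>p. p) \<phi> q = \<phi> q" by (simp add: fmap_def)
  qed
  ultimately show ?thesis by simp
qed

section \<open>Tensor relations\<close>

lemma add_subgroup_tens_rel: "add_subgroup (tens_rel X Y R rx ly)"
  using tens_rel.zero tens_rel.diff unfolding add_subgroup_def fun_diff_def zero_fun_def by blast

lemma fin_sums_diff: "\<phi> \<in> fin_sums \<Longrightarrow> \<psi> \<in> fin_sums \<Longrightarrow> (\<lambda>p. \<phi> p - \<psi> p) \<in> fin_sums"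
  using add_subgroup_diff[OF add_subgroup_fsums] unfolding fun_diff_def by blast

lemma tens_rel_fin_sums: "\<rho> \<in> tens_rel X Y R rx ly \<Longrightarrow> \<rho> \<in> fin_sums"
  by (induction rule: tens_rel.induct)
     (auto intro!: fin_sums_diff fgen_fsums simp: fin_sums_iff[of "\<lambda>_. 0"] fsupp_def[of "\<lambda>_. 0"])

lemma tens_rel_addl:
  "x \<in> X \<Longrightarrow> x' \<in> X \<Longrightarrow> y \<in> Y \<Longrightarrow>
    fgen (x + x') y - (fgen x y + fgen x' y) \<in> tens_rel X Y R rx ly"
  using tens_rel.addl[of x X x' y Y R rx ly] by (simp add: fun_diff_def diff_diff_eq)

lemma tens_rel_addr:
  "x \<in> X \<Longrightarrow> y \<in> Y \<Longrightarrow> y' \<in> Y \<Longrightarrow>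
    fgen x (y + y') - (fgen x y + fgen x y') \<in> tens_rel X Y R rx ly"
  using tens_rel.addr[of x X y Y y' R rx ly] by (simp add: fun_diff_def diff_diff_eq)

lemma tens_rel_bal:
  "x \<in> X \<Longrightarrow> r \<in> R \<Longrightarrow> y \<in> Y \<Longrightarrow> fgen (rx x r) y - fgen x (ly r y) \<in> tens_rel X Y R rx ly"
  using tens_rel.bal[of x X r R y Y rx ly] by (simp add: fun_diff_def)

lemma tens_rel_suml:
  assumes X: "add_subgroup X" and y: "y \<in> Y" and f: "\<And>i. i \<in> I \<Longrightarrow> f i \<in> X"
  shows "fgen (\<Sum>i\<in>I. f i) y - (\<Sum>i\<in>I. fgen (f i) y) \<in> tens_rel X Y R rx ly" (is "_ \<in> ?R")
proof -
  note R = add_subgroup_tens_rel[of X Y R rx ly]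
  note X0 = add_subgroup_zero[OF X]
  \<comment> \<open>Additivity with both summands 0. This is the claim for an empty index set, and
    for an infinite one, where both sums are 0 by convention.\<close>
  have z: "fgen 0 y \<in> ?R"
    using add_subgroup_sym[OF R tens_rel_addl[OF X0 X0 y, of R rx ly]] by simp
  show ?thesis
    using f
  proof (induction I rule: infinite_finite_induct)
    case (insert i I)
    have "fgen (f i + sum f I) y - (fgen (f i) y + fgen (sum f I) y) \<in> ?R"
      using insert by (intro tens_rel_addl add_subgroup_sum X y) auto
    moreover have "(fgen (f i) y + fgen (sum f I) y) - (fgen (f i) y + (\<Sum>i\<in>I. fgen (f i) y)) \<in> ?R"
      unfolding add_diff_cancel_left by (rule insert.IH) (simp add: insert.prems)
    ultimately show ?case
      unfolding sum.insert[OF insert.hyps] by (rule add_subgroup_trans[OF R])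
  qed (use z in simp_all)
qed

lemma tens_rel_sumr:
  assumes Y: "add_subgroup Y" and x: "x \<in> X" and f: "\<And>i. i \<in> I \<Longrightarrow> f i \<in> Y"
  shows "fgen x (\<Sum>i\<in>I. f i) - (\<Sum>i\<in>I. fgen x (f i)) \<in> tens_rel X Y R rx ly" (is "_ \<in> ?R")
proof -
  note R = add_subgroup_tens_rel[of X Y R rx ly]
  note Y0 = add_subgroup_zero[OF Y]
  have z: "fgen x 0 \<in> ?R"
    using add_subgroup_sym[OF R tens_rel_addr[OF x Y0 Y0, of R rx ly]] by simp
  show ?thesis
    using f
  proof (induction I rule: infinite_finite_induct)
    case (insert i I)
    have "fgen x (f i + sum f I) - (fgen x (f i) + fgen x (sum f I)) \<in> ?R"
      using insert by (intro tens_rel_addr add_subgroup_sum Y x) auto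
    moreover have "(fgen x (f i) + fgen x (sum f I)) - (fgen x (f i) + (\<Sum>i\<in>I. fgen x (f i))) \<in> ?R"
      unfolding add_diff_cancel_left by (rule insert.IH) (simp add: insert.prems)
    ultimately show ?case
      unfolding sum.insert[OF insert.hyps] by (rule add_subgroup_trans[OF R])
  qed (use z in simp_all)
qed

lemma fev_diff':
  "\<phi> \<in> fin_sums \<Longrightarrow> \<psi> \<in> fin_sums \<Longrightarrow> fev g (\<lambda>p. \<phi> p - \<psi> p) = fev g \<phi> - fev g \<psi>"
  using fev_diff[of \<phi> \<psi> g] by (simp only: fun_diff_def)

text \<open>Universal property of the tensor product, relative to a subgroup. With
  \<open>S = {0}\<close> it gives maps from a tensor product into a ring; with \<open>S\<close> a
  relation subgroup it gives maps between tensor products.\<close>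

lemma fev_tens_rel:
  assumes S: "add_subgroup S"
    and addl: "\<And>x x' y. x \<in> X \<Longrightarrow> x' \<in> X \<Longrightarrow> y \<in> Y \<Longrightarrow> k (x + x', y) - (k (x, y) + k (x', y)) \<in> S"
    and addr: "\<And>x y y'. x \<in> X \<Longrightarrow> y \<in> Y \<Longrightarrow> y' \<in> Y \<Longrightarrow> k (x, y + y') - (k (x, y) + k (x, y')) \<in> S"
    and bal: "\<And>x r y. x \<in> X \<Longrightarrow> r \<in> R \<Longrightarrow> y \<in> Y \<Longrightarrow> k (rx x r, y) - k (x, ly r y) \<in> S"
    and \<rho>: "\<rho> \<in> tens_rel X Y R rx ly"
  shows "fev k \<rho> \<in> S"
  using \<rho>
proof (induction rule: tens_rel.induct)
  case zero
  show ?case using S by (simp add: fev_zero[unfolded zero_fun_def] add_subgroup_zero)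
next
  case (diff \<phi> \<psi>)
  then show ?case
    using add_subgroup_diff[OF S] by (simp add: tens_rel_fin_sums fev_diff')
next
  case (addl x x' y)
  then have "k (x + x', y) - k (x, y) - k (x', y) \<in> S"
    using assms(2) by (simp add: diff_diff_eq)
  then show ?case
    by (simp add: fgen_fsums fin_sums_diff fev_diff')
next
  case (addr x y y')
  then have "k (x, y + y') - k (x, y) - k (x, y') \<in> S"
    using assms(3) by (simp add: diff_diff_eq)
  then show ?case
    by (simp add: fgen_fsums fin_sums_diff fev_diff')
next
  case (bal x r y)
  then show ?case
    using assms(4) by (simp add: fgen_fsums fin_sums_diff fev_diff')
qed

lemma add_subgroup_0: "add_subgroup {0}"
  by (simp add: add_subgroup_def)

lemma add_subgroup_UNIV: "add_subgroup UNIV"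
  by (simp add: add_subgroup_def)

section \<open>Casimir elements\<close>

abbreviation ring_rel :: "'a::ring_1 set \<Rightarrow> ('a \<times> 'a \<Rightarrow> int) set" where
  "ring_rel B \<equiv> tens_rel UNIV UNIV B (*) (*)"

text \<open>Only a representative is given, so equality of the two outer multiplications is stated
  as membership of the difference in the tensor relations.\<close>

definition casimir :: "'a::ring_1 set \<Rightarrow> ('a \<times> 'a \<Rightarrow> int) \<Rightarrow> bool" where
  "casimir B e \<longleftrightarrow> e \<in> fin_sums \<and>
     (\<forall>x. fmap (\<lambda>(a, b). (x * a, b)) e - fmap (\<lambda>(a, b). (a, b * x)) e \<in> ring_rel B)"

lemma centralizer_commute: "v \<in> centralizer B \<Longrightarrow> b \<in> B \<Longrightarrow> b * v = v * b"
  by (simp add: centralizer_def)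

lemma center_commute: "c \<in> centralizer UNIV \<Longrightarrow> x * c = c * x"
  by (simp add: centralizer_commute)

lemma centralizer_UNIV_subset: "c \<in> centralizer UNIV \<Longrightarrow> c \<in> centralizer B"
  by (simp add: centralizer_def)

lemma add_subgroup_centralizer: "add_subgroup (centralizer B)"
  by (simp add: add_subgroup_def centralizer_def algebra_simps)

lemma centralizer_mult: "v \<in> centralizer B \<Longrightarrow> w \<in> centralizer B \<Longrightarrow> v * w \<in> centralizer B"
  unfolding centralizer_def by (simp add: mult.assoc) (metis mult.assoc)

lemma one_centralizer: "1 \<in> centralizer B"
  by (simp add: centralizer_def)

lemma add_subgroup_free_mod:
  assumes "add_subgroup C"
  shows "add_subgroup (free_mod C n)"
  using assms by (simp add: add_subgroup_def free_mod_def)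

lemma mu_map_eq: "mu_map V e w = (if w \<in> V then fev (\<lambda>(x, y). x * w * y) e else 0)"
  by (simp add: mu_map_def fev_def case_prod_unfold mult.assoc)

text \<open>Elements of B can be moved past w, so x \<otimes> y \<mapsto> x w y is balanced over B.
  Hence \<open>mu_map\<close> depends only on the class in the tensor product.\<close>

lemma fev_ring_rel_eq_0:
  assumes "w \<in> centralizer B" "\<rho> \<in> ring_rel B"
  shows "fev (\<lambda>(x, y). x * w * y) \<rho> = 0"
proof -
  have "fev (\<lambda>(x, y). x * w * y) \<rho> \<in> {0}"
  proof (rule fev_tens_rel[OF add_subgroup_0 _ _ _ assms(2)])
    fix x r y :: 'a assume "r \<in> B"
    then have "x * r * w * y = x * w * (r * y)"
      using centralizer_commute[OF assms(1)] by (metis mult.assoc)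
    then show "(case (x * r, y) of (x, y) \<Rightarrow> x * w * y) - (case (x, r * y) of (x, y) \<Rightarrow> x * w * y) \<in> {0}"
      by simp
  qed (simp_all add: algebra_simps)
  then show ?thesis by simp
qed

text \<open>The map x \<otimes> y \<mapsto> x w y respects left and right multiplication by u, and
  these agree on the class of a Casimir element; its value therefore commutes with every u.\<close>

lemma fev_casimir_central:
  assumes e: "casimir B e" and w: "w \<in> centralizer B"
  shows "fev (\<lambda>(x, y). x * w * y) e \<in> centralizer UNIV"
proof -
  have "u * fev (\<lambda>(x, y). x * w * y) e = fev (\<lambda>(x, y). x * w * y) e * u" for u
  proof -
    have e': "e \<in> fin_sums" using e by (simp add: casimir_def)
    have "fev (\<lambda>(x, y). x * w * y)
        (fmap (\<lambda>(a, b). (u * a, b)) e - fmap (\<lambda>(a, b). (a, b * u)) e) = 0"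
      using e by (intro fev_ring_rel_eq_0[OF w]) (simp add: casimir_def)
    then have "fev (\<lambda>p. u * (case p of (x, y) \<Rightarrow> x * w * y)) e
        = fev (\<lambda>p. (case p of (x, y) \<Rightarrow> x * w * y) * u) e"
      using e' by (simp add: fev_diff fmap_fin_sums fev_fmap case_prod_unfold mult.assoc)
    then show ?thesis by (simp add: fev_mult_left fev_mult_right)
  qed
  then show ?thesis by (simp add: centralizer_def)
qed

section \<open>Strong separability as a dual basis with Casimir coordinates\<close>

lemma fmap_mult_left_ring_rel:
  assumes "\<rho> \<in> ring_rel B"
  shows "fmap (\<lambda>(a, b). (x * a, b)) \<rho> \<in> ring_rel B"
  unfolding fmap_eq_fev[OF tens_rel_fin_sums[OF assms]]
proof (rule fev_tens_rel[OF add_subgroup_tens_rel _ _ _ assms])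
  fix a r b :: 'a assume "r \<in> B"
  then show "fgen (fst (case (a * r, b) of (a, b) \<Rightarrow> (x * a, b))) (snd (case (a * r, b) of (a, b) \<Rightarrow> (x * a, b)))
      - fgen (fst (case (a, r * b) of (a, b) \<Rightarrow> (x * a, b))) (snd (case (a, r * b) of (a, b) \<Rightarrow> (x * a, b)))
      \<in> ring_rel B"
    using tens_rel_bal[of "x * a" UNIV r B b UNIV "(*)" "(*)"] by (simp add: mult.assoc)
qed (simp_all add: distrib_left tens_rel_addl tens_rel_addr)

lemma fmap_add_left_ring_rel:
  assumes "e \<in> fin_sums"
  shows "fmap (\<lambda>(a, b). ((x + y) * a, b)) e
    - (fmap (\<lambda>(a, b). (x * a, b)) e + fmap (\<lambda>(a, b). (y * a, b)) e) \<in> ring_rel B"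
proof -
  have "fev (\<lambda>(a, b). fgen ((x + y) * a) b) e - fev (\<lambda>(a, b). fgen (x * a) b + fgen (y * a) b) e
      \<in> ring_rel B"
    using add_subgroup_tens_rel assms
    by (rule fev_mem_cong) (simp add: distrib_right tens_rel_addl)
  moreover have "fev (\<lambda>(a, b). fgen (x * a) b + fgen (y * a) b) e
      = fmap (\<lambda>(a, b). (x * a, b)) e + fmap (\<lambda>(a, b). (y * a, b)) e"
    using assms by (simp add: fmap_eq_fev fev_def case_prod_unfold distrib_left sum.distrib)
  ultimately show ?thesis
    using assms by (simp add: fmap_eq_fev case_prod_unfold)
qed

text \<open>The \<open>v i\<close> are the images of the unit vectors under the projection of a free
  C-module onto V. Each \<open>e i\<close> is the value of the section at the i-th coordinate map,
  and \<open>mu_map\<close> turns it back into that coordinate.\<close>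

lemma strongly_separableD:
  assumes "strongly_separable (B :: 'a::ring_1 set)"
  obtains n :: nat and v e where "\<And>i. i < n \<Longrightarrow> v i \<in> centralizer B" "\<And>i. i < n \<Longrightarrow> casimir B (e i)"
    "\<And>w. w \<in> centralizer B \<Longrightarrow> (\<Sum>i<n. v i * mu_map (centralizer B) (e i) w) = w"
proof -
  define V where "V = centralizer B"
  define C where "C = centralizer (UNIV :: 'a set)"
  have V: "add_subgroup V" and C: "add_subgroup C"
    by (simp_all add: V_def C_def add_subgroup_centralizer)
  from assms have fgp: "fgp_right C V"
    and "\<exists>s. (\<forall>h\<in>hom_right C V. s h \<in> fin_sums)
           \<and> (\<forall>h\<in>hom_right C V. \<forall>g\<in>hom_right C V. (\<lambda>p. s (\<lambda>v. h v + g v) p - s h p - s g p) \<in> ring_rel B)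
           \<and> (\<forall>h\<in>hom_right C V. \<forall>x y. (\<lambda>p. s (\<lambda>v. x * h v * y) p
                               - fmap (\<lambda>(a, b). (x * a, b * y)) (s h) p) \<in> ring_rel B)
           \<and> (\<forall>h\<in>hom_right C V. mu_map V (s h) = h)"
    unfolding strongly_separable_def Let_def V_def C_def by blast+
  then obtain s where s: "\<And>h. h \<in> hom_right C V \<Longrightarrow> s h \<in> fin_sums"
    and bil: "\<And>h x y. h \<in> hom_right C V \<Longrightarrow>
        s (\<lambda>v. x * h v * y) - fmap (\<lambda>(a, b). (x * a, b * y)) (s h) \<in> ring_rel B"
    and mu: "\<And>h. h \<in> hom_right C V \<Longrightarrow> mu_map V (s h) = h"
    unfolding fun_diff_def by blast
  from fgp obtain n p q where
    "\<forall>v\<in>V. p v \<in> free_mod C n" and "\<forall>c\<in>free_mod C n. q c \<in> V"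
    and "\<forall>v\<in>V. \<forall>w\<in>V. p (v + w) = (\<lambda>i. p v i + p w i)"
    and "\<forall>v\<in>V. \<forall>c\<in>C. p (v * c) = (\<lambda>i. p v i * c)"
    and "\<forall>x\<in>free_mod C n. \<forall>y\<in>free_mod C n. q (\<lambda>i. x i + y i) = q x + q y"
    and "\<forall>x\<in>free_mod C n. \<forall>c\<in>C. q (\<lambda>i. x i * c) = q x * c"
    and "\<forall>v\<in>V. q (p v) = v"
    unfolding fgp_right_def by (elim exE conjE) (rule that)
  note p = this(1)[rule_format] and q = this(2)[rule_format] and p_add = this(3)[rule_format]
    and p_mult = this(4)[rule_format] and q_add = this(5)[rule_format]
    and q_mult = this(6)[rule_format] and qp = this(7)[rule_format]
  define u where "u i = (\<lambda>j. if j = i then 1 else 0 :: 'a)" for i :: nat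
  \<comment> \<open>Members of \<open>hom_right C V\<close> vanish outside V, so the coordinates are
    extended by 0.\<close>
  define h where "h i w = (if w \<in> V then p w i else 0)" for i w
  have u: "u i \<in> free_mod C n" if "i < n" for i
    using that by (auto simp: u_def free_mod_def C_def one_centralizer add_subgroup_zero[OF C[unfolded C_def]])
  have pC: "p w i \<in> C" if "w \<in> V" for w i
    using p[OF that] add_subgroup_zero[OF C] by (cases "i < n") (auto simp: free_mod_def)
  have h: "h i \<in> hom_right C V" for i
    unfolding hom_right_def h_def
    by (auto simp: p_add p_mult add_subgroup_add[OF V])
      (auto simp: V_def C_def centralizer_mult centralizer_UNIV_subset)
  show ?thesis
  proof (rule that[of n "\<lambda>i. q (u i)" "\<lambda>i. s (h i)"])
    show "q (u i) \<in> centralizer B" if "i < n" for i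
      using q[OF u[OF that]] by (simp add: V_def)
    show "casimir B (s (h i))" for i
      unfolding casimir_def
    proof (intro conjI allI)
      fix x
      \<comment> \<open>Coordinates have central values, so multiplying by x on the left or on the
        right gives one and the same map. Bilinearity of the section, applied to both forms, is the
        Casimir relation; the factors 1 bring them into the shape of \<open>bil\<close>.\<close>
      have "x * h i w * 1 = 1 * h i w * x" for w
        using pC[of w i] by (simp add: h_def C_def center_commute[of "p w i" x])
      then have eq: "(\<lambda>w. x * h i w * 1) = (\<lambda>w. 1 * h i w * x)" by blast
      note R = add_subgroup_tens_rel[of UNIV UNIV B "(*)" "(*)"]
      have "fmap (\<lambda>(a, b). (x * a, b * 1)) (s (h i)) - fmap (\<lambda>(a, b). (1 * a, b * x)) (s (h i)) \<in> ring_rel B"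
        using add_subgroup_sym[OF R bil[OF h[of i], where x=x and y=1]]
          bil[OF h[of i], where x=1 and y=x, folded eq]
        by (rule add_subgroup_trans[OF R])
      then show "fmap (\<lambda>(a, b). (x * a, b)) (s (h i)) - fmap (\<lambda>(a, b). (a, b * x)) (s (h i)) \<in> ring_rel B"
        by simp
    qed (rule s[OF h])
    show "(\<Sum>i<n. q (u i) * mu_map (centralizer B) (s (h i)) w) = w" if "w \<in> centralizer B" for w
    proof -
      have w: "w \<in> V" using that by (simp add: V_def)
      have "p w = (\<Sum>i<n. (\<lambda>j. u i j * p w i))"
      proof
        fix j
        show "p w j = (\<Sum>i<n. (\<lambda>j. u i j * p w i)) j"
          using p[OF w] by (simp add: sum_fun_apply u_def free_mod_def if_distrib[of "\<lambda>x. x * _"]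
              sum.delta cong: if_cong)
      qed
      then have "w = q (\<Sum>i<n. (\<lambda>j. u i j * p w i))"
        using qp[OF w] by simp
      also have "\<dots> = (\<Sum>i<n. q (\<lambda>j. u i j * p w i))"
      proof (rule additive_sum[OF add_subgroup_free_mod[OF C]])
        show "q (x + y) = q x + q y" if "x \<in> free_mod C n" "y \<in> free_mod C n" for x y
          using q_add[OF that] by (simp add: plus_fun_def)
        show "(\<lambda>j. u i j * p w i) \<in> free_mod C n" if "i \<in> {..<n}" for i
          using that pC[OF w] add_subgroup_zero[OF C] by (auto simp: u_def free_mod_def)
      qed
      also have "\<dots> = (\<Sum>i<n. q (u i) * mu_map (centralizer B) (s (h i)) w)"
        using w by (intro sum.cong refl) (simp add: q_mult u pC mu[OF h, unfolded V_def] h_def)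
      finally show ?thesis by simp
    qed
  qed
qed

text \<open>Left linearity of the section is built into its form, and right linearity is the Casimir
  property. It is a section because the coordinates of w are central: C-linearity of h moves them
  inside, and the dual basis identity gives h(w).\<close>

lemma strongly_separableI:
  fixes B :: "'a::ring_1 set"
  assumes v: "\<And>i. i < (n::nat) \<Longrightarrow> v i \<in> centralizer B" and e: "\<And>i. i < n \<Longrightarrow> casimir B (e i)"
    and ve: "\<And>w. w \<in> centralizer B \<Longrightarrow> (\<Sum>i<n. v i * fev (\<lambda>(x, y). x * w * y) (e i)) = w"
  shows "strongly_separable B"
proof -
  define V where "V = centralizer B"
  define C where "C = centralizer (UNIV :: 'a set)"
  define m where "m i w = fev (\<lambda>(x, y). x * w * y) (e i)" for i w
  define s where "s h = (\<Sum>i<n. fmap (\<lambda>(a, b). (h (v i) * a, b)) (e i))" for h :: "'a \<Rightarrow> 'a"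
  note R = add_subgroup_tens_rel[of UNIV UNIV B "(*)" "(*)"]
  have V: "add_subgroup V" and C: "add_subgroup C"
    by (simp_all add: V_def C_def add_subgroup_centralizer)
  have CV: "c \<in> V" if "c \<in> C" for c
    using that by (simp add: V_def C_def centralizer_UNIV_subset)
  have VC: "x * c \<in> V" if "x \<in> V" "c \<in> C" for x c
    using that CV[OF that(2)] by (simp add: V_def centralizer_mult)
  have vV: "v i \<in> V" if "i < n" for i
    using v[OF that] by (simp add: V_def)
  have ef: "e i \<in> fin_sums" if "i < n" for i
    using e[OF that] by (simp add: casimir_def)
  have mC: "m i w \<in> C" if "i < n" "w \<in> V" for i w
    using fev_casimir_central[OF e] that by (simp add: m_def V_def C_def)
  have m_add: "m i (w + w') = m i w + m i w'" for i w w'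
    by (simp add: m_def fev_def case_prod_unfold algebra_simps sum.distrib)
  have m_mult: "m i (w * c) = m i w * c" if "c \<in> C" for i w c
  proof -
    have "y * c = c * y" for y
      using that by (simp add: C_def center_commute)
    then have "x * (w * c) * y = x * w * y * c" for x y
      by (metis mult.assoc)
    then have "m i (w * c) = fev (\<lambda>p. (case p of (x, y) \<Rightarrow> x * w * y) * c) (e i)"
      unfolding m_def by (intro arg_cong[of _ _ "\<lambda>g. fev g (e i)"]) (auto simp: fun_eq_iff)
    then show ?thesis by (simp add: fev_mult_right m_def)
  qed
  have vm: "(\<Sum>i<n. v i * m i w) = w" if "w \<in> V" for w
    using ve that by (simp add: V_def m_def)
  have "fgp_right C V"
    unfolding fgp_right_def
  proof (intro exI conjI ballI)
    \<comment> \<open>Cut off at \<open>n\<close>, as \<open>free_mod\<close> requires zero entries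
      from there on.\<close>
    let ?p = "\<lambda>w i. if i < n then m i w else 0" and ?q = "\<lambda>c. \<Sum>i<n. v i * c i"
    show "?p w \<in> free_mod C n" if "w \<in> V" for w
      using that by (simp add: free_mod_def mC)
    show "?q c \<in> V" if "c \<in> free_mod C n" for c
      using that by (intro add_subgroup_sum[OF V] VC vV) (auto simp: free_mod_def)
    show "?q (?p w) = w" if "w \<in> V" for w
      using vm[OF that] by simp
  qed (auto simp: m_add m_mult distrib_left sum.distrib sum_distrib_right mult.assoc)
  moreover have "(\<forall>h\<in>hom_right C V. s h \<in> fin_sums)
           \<and> (\<forall>h\<in>hom_right C V. \<forall>g\<in>hom_right C V. (\<lambda>p. s (\<lambda>v. h v + g v) p - s h p - s g p) \<in> ring_rel B)
           \<and> (\<forall>h\<in>hom_right C V. \<forall>x y. (\<lambda>p. s (\<lambda>v. x * h v * y) p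
                               - fmap (\<lambda>(a, b). (x * a, b * y)) (s h) p) \<in> ring_rel B)
           \<and> (\<forall>h\<in>hom_right C V. mu_map V (s h) = h)"
  proof (intro conjI ballI allI)
    show "s h \<in> fin_sums" for h
      unfolding s_def by (intro add_subgroup_sum[OF add_subgroup_fsums] fmap_fin_sums ef) simp
    show "(\<lambda>p. s (\<lambda>v. h v + g v) p - s h p - s g p) \<in> ring_rel B" for h g
    proof -
      have "s (\<lambda>v. h v + g v) - (s h + s g) \<in> ring_rel B"
        unfolding s_def sum.distrib[symmetric]
        by (intro add_subgroup_sum_cong[OF R] fmap_add_left_ring_rel ef) simp
      then show ?thesis by (simp add: fun_diff_def diff_diff_eq)
    qed
    show "(\<lambda>p. s (\<lambda>v. x * h v * y) p - fmap (\<lambda>(a, b). (x * a, b * y)) (s h) p) \<in> ring_rel B" for h x y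
    proof -
      have "fmap (\<lambda>(a, b). (x * h (v i) * y * a, b)) (e i)
          - fmap (\<lambda>(a, b). (x * a, b * y)) (fmap (\<lambda>(a, b). (h (v i) * a, b)) (e i)) \<in> ring_rel B"
        if "i < n" for i
      proof -
        \<comment> \<open>The Casimir relation for y, multiplied from the left by x h(v_i): it
          exchanges y in front of \<open>e i\<close> with y behind it.\<close>
        have "fmap (\<lambda>(a, b). (x * h (v i) * a, b))
            (fmap (\<lambda>(a, b). (y * a, b)) (e i) - fmap (\<lambda>(a, b). (a, b * y)) (e i)) \<in> ring_rel B"
          using e[OF that] by (intro fmap_mult_left_ring_rel) (simp add: casimir_def)
        then show ?thesis
          using ef[OF that] by (simp add: fmap_diff fmap_fin_sums fmap_fmap case_prod_unfold mult.assoc)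
      qed
      then have "s (\<lambda>v. x * h v * y) - fmap (\<lambda>(a, b). (x * a, b * y)) (s h) \<in> ring_rel B"
        unfolding s_def by (subst fmap_sum) (auto intro!: add_subgroup_sum_cong[OF R] fmap_fin_sums ef)
      then show ?thesis by (simp add: fun_diff_def)
    qed
    show "mu_map V (s h) = h" if h: "h \<in> hom_right C V" for h
    proof
      fix w
      show "mu_map V (s h) w = h w"
      proof (cases "w \<in> V")
        case True
        have "mu_map V (s h) w = (\<Sum>i<n. fev (\<lambda>p. h (v i) * (case p of (x, y) \<Rightarrow> x * w * y)) (e i))"
          using True unfolding s_def mu_map_eq
          by (subst fev_sum)
            (auto intro!: fmap_fin_sums ef sum.cong simp: fev_fmap ef case_prod_unfold mult.assoc)
        also have "\<dots> = (\<Sum>i<n. h (v i * m i w))"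
          using h True by (simp add: fev_mult_left m_def[symmetric] hom_right_def vV mC)
        also have "\<dots> = h (\<Sum>i<n. v i * m i w)"
          using h by (intro additive_sum[OF V, symmetric]) (auto simp: hom_right_def vV mC VC True)
        finally show ?thesis by (simp add: vm True)
      next
        case False
        then show ?thesis using h by (simp add: mu_map_eq hom_right_def)
      qed
    qed
  qed
  ultimately show ?thesis
    unfolding strongly_separable_def Let_def V_def C_def by blast
qed

section \<open>Transfer along a Morita bimodule\<close>

lemma additive_fev:
  assumes add: "\<And>x y. h (x + y) = h x + h y"
  shows "h (fev g \<phi>) = fev (\<lambda>p. h (g p)) \<phi>"
proof -
  have h0: "h 0 = 0" using add[of 0 0] by simp
  have hdiff: "h (x - y) = h x - h y" for x y
    using add[of "x - y" y] by simp
  have "h (of_int k * x) = of_int k * h x" for k x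
  proof (induction k rule: int_induct[where k=0])
    case (step1 i)
    then show ?case by (simp add: distrib_right add)
  next
    case (step2 i)
    then show ?case by (simp add: left_diff_distrib hdiff)
  qed (simp add: h0)
  then show ?thesis
    unfolding fev_def by (subst additive_sum[OF add_subgroup_UNIV]) (simp_all add: add)
qed

text \<open>\<open>I\<close> plays the role of the image of \<open>N\<close> in \<open>M\<close>; \<open>F\<close> and \<open>n\<close> form a dual basis of \<open>M\<close>, and
  \<open>G\<close> and \<open>m\<close> witness that \<open>M\<close> is a generator. The last assumption says that the
  endomorphisms \<open>z \<mapsto> G k z b x\<close>, which preserve \<open>I\<close>, come from \<open>B'\<close>.\<close>

locale morita_ctx =
  fixes B :: "'a::ring_1 set" and B' :: "'b::ring_1 set"
    and M :: "'m::ab_group_add set" and lm :: "'a \<Rightarrow> 'm \<Rightarrow> 'm" and rm :: "'m \<Rightarrow> 'b \<Rightarrow> 'm"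
    and I :: "'m set"
    and J :: nat and F :: "nat \<Rightarrow> 'm \<Rightarrow> 'a" and n :: "nat \<Rightarrow> 'm"
    and K :: nat and G :: "nat \<Rightarrow> 'm \<Rightarrow> 'a" and m :: "nat \<Rightarrow> 'm"
  assumes one_B: "1 \<in> B"
    and bimod: "bimod UNIV UNIV M lm rm"
    and endo: "\<And>\<phi>. \<lbrakk>\<forall>x\<in>M. \<phi> x \<in> M; \<forall>x\<in>M. \<forall>y\<in>M. \<phi> (x + y) = \<phi> x + \<phi> y;
        \<forall>a. \<forall>x\<in>M. \<phi> (lm a x) = lm a (\<phi> x)\<rbrakk> \<Longrightarrow> \<exists>!s. \<forall>x\<in>M. \<phi> x = rm x s"
    and I_M: "\<And>x. x \<in> I \<Longrightarrow> x \<in> M"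
    and I_lm: "\<And>b x. b \<in> B \<Longrightarrow> x \<in> I \<Longrightarrow> lm b x \<in> I"
    and I_rm: "\<And>b x. b \<in> B' \<Longrightarrow> x \<in> I \<Longrightarrow> rm x b \<in> I"
    and F_add: "\<And>j x y. j < J \<Longrightarrow> x \<in> M \<Longrightarrow> y \<in> M \<Longrightarrow> F j (x + y) = F j x + F j y"
    and F_lm: "\<And>j a x. j < J \<Longrightarrow> x \<in> M \<Longrightarrow> F j (lm a x) = a * F j x"
    and F_I: "\<And>j x. j < J \<Longrightarrow> x \<in> I \<Longrightarrow> F j x \<in> B"
    and n_I: "\<And>j. j < J \<Longrightarrow> n j \<in> I"
    and F_n: "\<And>x. x \<in> M \<Longrightarrow> (\<Sum>j<J. lm (F j x) (n j)) = x"
    and G_add: "\<And>k x y. k < K \<Longrightarrow> x \<in> M \<Longrightarrow> y \<in> M \<Longrightarrow> G k (x + y) = G k x + G k y"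
    and G_lm: "\<And>k a x. k < K \<Longrightarrow> x \<in> M \<Longrightarrow> G k (lm a x) = a * G k x"
    and m_I: "\<And>k. k < K \<Longrightarrow> m k \<in> I"
    and G_m: "(\<Sum>k<K. G k (m k)) = 1"
    and G_B': "\<And>k b x. k < K \<Longrightarrow> b \<in> B \<Longrightarrow> x \<in> I \<Longrightarrow>
        \<exists>b'\<in>B'. \<forall>z\<in>M. rm z b' = lm (G k z * b) x"
begin

lemma M_group: "add_subgroup M"
  using bimod by (simp add: bimod_def add_subgroup_def)

lemma M_lm: "x \<in> M \<Longrightarrow> lm a x \<in> M"
  and M_rm: "x \<in> M \<Longrightarrow> rm x s \<in> M"
  and lm_add: "x \<in> M \<Longrightarrow> y \<in> M \<Longrightarrow> lm a (x + y) = lm a x + lm a y"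
  and add_lm: "x \<in> M \<Longrightarrow> lm (a + b) x = lm a x + lm b x"
  and mult_lm: "x \<in> M \<Longrightarrow> lm (a * b) x = lm a (lm b x)"
  and one_lm: "x \<in> M \<Longrightarrow> lm 1 x = x"
  and rm_add: "x \<in> M \<Longrightarrow> y \<in> M \<Longrightarrow> rm (x + y) s = rm x s + rm y s"
  and add_rm: "x \<in> M \<Longrightarrow> rm x (s + t) = rm x s + rm x t"
  and mult_rm: "x \<in> M \<Longrightarrow> rm x (s * t) = rm (rm x s) t"
  and rm_lm: "x \<in> M \<Longrightarrow> rm (lm a x) s = lm a (rm x s)"
  using bimod by (auto simp: bimod_def)

lemma lm_sum: "(\<And>i. i \<in> S \<Longrightarrow> x i \<in> M) \<Longrightarrow> lm a (\<Sum>i\<in>S. x i) = (\<Sum>i\<in>S. lm a (x i))"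
  by (rule additive_sum[OF M_group lm_add])

lemma sum_lm: "x \<in> M \<Longrightarrow> lm (\<Sum>i\<in>S. a i) x = (\<Sum>i\<in>S. lm (a i) x)"
  using additive_sum[OF add_subgroup_UNIV, of "\<lambda>a. lm a x" S a] by (simp add: add_lm)

lemma rm_sum: "(\<And>i. i \<in> S \<Longrightarrow> x i \<in> M) \<Longrightarrow> rm (\<Sum>i\<in>S. x i) s = (\<Sum>i\<in>S. rm (x i) s)"
  using additive_sum[OF M_group, of "\<lambda>x. rm x s" S x] by (simp add: rm_add)

lemma sum_rm: "x \<in> M \<Longrightarrow> rm x (\<Sum>i\<in>S. s i) = (\<Sum>i\<in>S. rm x (s i))"
  using additive_sum[OF add_subgroup_UNIV, of "\<lambda>s. rm x s" S s] by (simp add: add_rm)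

lemma n_M: "j < J \<Longrightarrow> n j \<in> M" and m_M: "k < K \<Longrightarrow> m k \<in> M"
  by (simp_all add: I_M n_I m_I)

text \<open>M is faithful over \<open>A'\<close>: this is the uniqueness in \<open>endo\<close>,
  applied to right multiplication by s.\<close>

lemma rm_eqI:
  assumes "\<And>z. z \<in> M \<Longrightarrow> rm z s = rm z t"
  shows "s = t"
proof -
  have "\<exists>!s'. \<forall>x\<in>M. rm x s = rm x s'"
    by (rule endo) (simp_all add: M_rm rm_add rm_lm)
  then show ?thesis using assms by metis
qed

text \<open>The \<open>n j\<close> lie in I and generate M over A, and right multiplications are
  A-linear.\<close>

lemma rm_eqI_I:
  assumes "\<And>x. x \<in> I \<Longrightarrow> rm x s = rm x t"
  shows "s = t"
proof (rule rm_eqI)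
  fix z assume z: "z \<in> M"
  have "rm z s = (\<Sum>j<J. lm (F j z) (rm (n j) s))" for s
    using rm_sum[of "{..<J}" "\<lambda>j. lm (F j z) (n j)" s] F_n[OF z] by (simp add: M_lm n_M rm_lm)
  then show "rm z s = rm z t" using assms n_I by simp
qed

section \<open>The pairing of M with its dual\<close>

definition functional :: "('m \<Rightarrow> 'a) \<Rightarrow> bool" where
  "functional f \<longleftrightarrow> (\<forall>x\<in>M. \<forall>y\<in>M. f (x + y) = f x + f y) \<and> (\<forall>a. \<forall>x\<in>M. f (lm a x) = a * f x)"

text \<open>The Morita pairing with values in \<open>A'\<close>: for a functional f, the
  endomorphism z \<mapsto> f(z) x of M is right multiplication by a unique element.\<close>

definition br :: "('m \<Rightarrow> 'a) \<Rightarrow> 'm \<Rightarrow> 'b" where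
  "br f x = (THE s. \<forall>z\<in>M. lm (f z) x = rm z s)"

lemma functional_F: "j < J \<Longrightarrow> functional (F j)"
  by (simp add: functional_def F_add F_lm)

lemma functional_G: "k < K \<Longrightarrow> functional (G k)"
  by (simp add: functional_def G_add G_lm)

lemma rm_br:
  assumes f: "functional f" and x: "x \<in> M" and z: "z \<in> M"
  shows "rm z (br f x) = lm (f z) x"
proof -
  have "\<exists>!s. \<forall>z\<in>M. lm (f z) x = rm z s"
    using f x by (intro endo) (simp_all add: functional_def M_lm add_lm mult_lm)
  from theI'[OF this] show ?thesis using z by (simp add: br_def)
qed

lemma br_add: "functional f \<Longrightarrow> x \<in> M \<Longrightarrow> y \<in> M \<Longrightarrow> br f (x + y) = br f x + br f y"
  by (rule rm_eqI) (simp add: rm_br add_rm add_subgroup_add[OF M_group] lm_add)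

lemma br_sum:
  "functional f \<Longrightarrow> (\<And>i. i \<in> S \<Longrightarrow> x i \<in> M) \<Longrightarrow> br f (\<Sum>i\<in>S. x i) = (\<Sum>i\<in>S. br f (x i))"
  by (rule additive_sum[OF M_group br_add])

lemma br_mult: "functional f \<Longrightarrow> x \<in> M \<Longrightarrow> br f x * s = br f (rm x s)"
  by (rule rm_eqI) (simp add: rm_br mult_rm M_rm rm_lm)

lemma functional_rm:
  assumes "functional f" "z \<in> M"
  shows "f (rm z s) = (\<Sum>i<J. F i z * f (rm (n i) s))"
proof -
  have "f (rm z s) = f (\<Sum>i<J. lm (F i z) (rm (n i) s))"
    using F_n[OF assms(2)] rm_sum[of "{..<J}" "\<lambda>j. lm (F j z) (n j)" s]
    by (simp add: M_lm n_M rm_lm)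
  also have "\<dots> = (\<Sum>i<J. f (lm (F i z) (rm (n i) s)))"
    using assms(1) by (intro additive_sum[OF M_group]) (auto simp: functional_def M_lm M_rm n_M)
  also have "\<dots> = (\<Sum>i<J. F i z * f (rm (n i) s))"
    using assms(1) by (intro sum.cong refl) (simp add: functional_def M_rm n_M)
  finally show ?thesis .
qed

text \<open>The ring \<open>A'\<close> acts on functionals by (s f)(z) = f(z s), and s times the
  pairing of f with x is the pairing of s f with x. Expanding s f in the dual basis leaves only the
  \<open>F i\<close> as functionals and puts the coefficients f(n_i s) in front of x.\<close>

lemma mult_br:
  assumes "functional f" "x \<in> M"
  shows "s * br f x = (\<Sum>i<J. br (F i) (lm (f (rm (n i) s)) x))"
  by (rule rm_eqI)
    (simp add: assms mult_rm rm_br M_rm sum_rm functional_F M_lm functional_rm[OF assms(1)] sum_lm mult_lm)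

lemma G_generate:
  assumes "x \<in> M"
  shows "(\<Sum>k<K. lm (a * G k (m k)) x) = lm a x"
  using assms by (simp add: sum_lm[symmetric] sum_distrib_left[symmetric] G_m)

text \<open>The map \<open>a \<otimes> b \<mapsto> f a \<otimes> 1 \<otimes> b x\<close> from \<open>A \<otimes>\<^sub>B A\<close> to \<open>A' \<otimes>\<^sub>B\<^sub>' A' = N* \<otimes>\<^sub>B A \<otimes>\<^sub>B A \<otimes>\<^sub>B N\<close>, where the
  middle \<open>1\<close> in \<open>B = N \<otimes>\<^sub>B\<^sub>' N*\<close> is the sum of the \<open>m k \<otimes> G k\<close>.\<close>

definition phi :: "('m \<Rightarrow> 'a) \<Rightarrow> 'm \<Rightarrow> 'a \<times> 'a \<Rightarrow> ('b \<times> 'b \<Rightarrow> int)" where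
  "phi f x = (\<lambda>(a, b). \<Sum>k<K. fgen (br f (lm a (m k))) (br (G k) (lm b x)))"

abbreviation "R' \<equiv> ring_rel B'"

lemma R'_group: "add_subgroup R'"
  by (rule add_subgroup_tens_rel)

lemma phi_fin_sums: "phi f x p \<in> fin_sums"
  unfolding phi_def by (auto split: prod.split intro!: add_subgroup_sum[OF add_subgroup_fsums] fgen_fsums)

text \<open>The element b is represented by the matrix \<beta> over \<open>B'\<close> with z
  \<beta>_lk = G_l(z) b m_k, supplied by \<open>G_B'\<close>. Writing [f, x] for the pairing,
  [f, a b m_k] is the sum over l of [f, a m_l] \<beta>_lk, and [G_l, b c x] is the sum over k of
  \<beta>_lk [G_k, c x]. Moving b across the first tensor sign thus amounts to moving the \<beta>_lk
  across the second.\<close>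

lemma phi_balanced:
  assumes f: "functional f" and x: "x \<in> M" and b: "b \<in> B"
  shows "phi f x (a * b, c) - phi f x (a, b * c) \<in> R'"
proof -
  obtain \<beta> where \<beta>: "\<And>l k. l < K \<Longrightarrow> k < K \<Longrightarrow> \<beta> l k \<in> B'"
    and \<beta>_rm: "\<And>l k z. l < K \<Longrightarrow> k < K \<Longrightarrow> z \<in> M \<Longrightarrow> rm z (\<beta> l k) = lm (G l z * b) (m k)"
  proof -
    have "\<forall>l k. \<exists>b'. l < K \<longrightarrow> k < K \<longrightarrow> b' \<in> B' \<and> (\<forall>z\<in>M. rm z b' = lm (G l z * b) (m k))"
      using G_B'[OF _ b m_I] by blast
    then show ?thesis using that by metis
  qed
  let ?f = "\<lambda>l. br f (lm a (m l))" and ?g = "\<lambda>k. br (G k) (lm c x)"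
  have 1: "br f (lm (a * b) (m k)) = (\<Sum>l<K. ?f l * \<beta> l k)" if k: "k < K" for k
  proof (rule rm_eqI)
    fix z assume z: "z \<in> M"
    have "rm z (\<Sum>l<K. ?f l * \<beta> l k) = (\<Sum>l<K. lm (f z * a) (lm (G l (m l) * b) (m k)))"
      unfolding sum_rm[OF z]
      by (intro sum.cong refl) (simp add: z k f mult_rm rm_br M_lm m_M rm_lm \<beta>_rm G_lm mult_lm[symmetric] mult.assoc)
    also have "\<dots> = lm (f z * a) (\<Sum>l<K. lm (1 * G l (m l)) (lm b (m k)))"
      using k by (subst lm_sum) (simp_all add: mult_lm M_lm m_M)
    also have "\<dots> = rm z (br f (lm (a * b) (m k)))"
      using z k by (simp add: G_generate[of _ 1, simplified] M_lm m_M rm_br f one_lm mult_lm)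
    finally show "rm z (br f (lm (a * b) (m k))) = rm z (\<Sum>l<K. ?f l * \<beta> l k)" by simp
  qed
  have 2: "br (G l) (lm (b * c) x) = (\<Sum>k<K. \<beta> l k * ?g k)" if l: "l < K" for l
  proof (rule rm_eqI)
    fix z assume z: "z \<in> M"
    have "rm z (\<Sum>k<K. \<beta> l k * ?g k) = (\<Sum>k<K. lm (G l z * b * G k (m k)) (lm c x))"
      unfolding sum_rm[OF z]
      by (intro sum.cong refl)
        (simp add: z l x mult_rm rm_br M_lm M_rm functional_G m_M \<beta>_rm G_lm)
    also have "\<dots> = rm z (br (G l) (lm (b * c) x))"
      using z l x by (subst G_generate) (simp_all add: M_lm rm_br functional_G mult_lm)
    finally show "rm z (br (G l) (lm (b * c) x)) = rm z (\<Sum>k<K. \<beta> l k * ?g k)" by simp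
  qed
  have s1: "phi f x (a * b, c) - (\<Sum>k<K. \<Sum>l<K. fgen (?f l * \<beta> l k) (?g k)) \<in> R'"
    unfolding phi_def prod.case
    by (intro add_subgroup_sum_cong[OF R'_group])
      (simp add: 1 tens_rel_suml[OF add_subgroup_UNIV])
  have s2: "(\<Sum>k<K. \<Sum>l<K. fgen (?f l * \<beta> l k) (?g k)) - (\<Sum>k<K. \<Sum>l<K. fgen (?f l) (\<beta> l k * ?g k)) \<in> R'"
    by (intro add_subgroup_sum_cong[OF R'_group]) (simp add: tens_rel_bal \<beta>)
  have s3: "phi f x (a, b * c) - (\<Sum>k<K. \<Sum>l<K. fgen (?f l) (\<beta> l k * ?g k)) \<in> R'"
    unfolding phi_def prod.case sum.swap[of "\<lambda>k l. fgen (?f l) (\<beta> l k * ?g k)"]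
    by (intro add_subgroup_sum_cong[OF R'_group])
      (simp add: 2 tens_rel_sumr[OF add_subgroup_UNIV])
  show ?thesis
    by (rule add_subgroup_trans[OF R'_group add_subgroup_trans[OF R'_group s1 s2]
          add_subgroup_sym[OF R'_group s3]])
qed

text \<open>By this, \<open>phi f x\<close> induces a map from the tensor product over B to the one
  over \<open>B'\<close>.\<close>

lemma fev_phi_ring_rel:
  assumes f: "functional f" and x: "x \<in> M" and \<rho>: "\<rho> \<in> ring_rel B"
  shows "fev (phi f x) \<rho> \<in> R'"
proof (rule fev_tens_rel[OF R'_group _ _ _ \<rho>])
  show "phi f x (a + a', b) - (phi f x (a, b) + phi f x (a', b)) \<in> R'" for a a' b
    unfolding phi_def prod.case sum.distrib[symmetric]
    by (intro add_subgroup_sum_cong[OF R'_group])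
      (simp add: add_lm m_M br_add f M_lm tens_rel_addl)
  show "phi f x (a, b + b') - (phi f x (a, b) + phi f x (a, b')) \<in> R'" for a b b'
    unfolding phi_def prod.case sum.distrib[symmetric]
    by (intro add_subgroup_sum_cong[OF R'_group])
      (simp add: add_lm x br_add functional_G M_lm tens_rel_addr)
qed (rule phi_balanced[OF f x])

definition transport :: "('a \<times> 'a \<Rightarrow> int) \<Rightarrow> ('b \<times> 'b \<Rightarrow> int)" where
  "transport e = (\<Sum>j<J. fev (phi (F j) (n j)) e)"

text \<open>Let c_ij = F_j(n_i s) be the matrix of right multiplication by s. It describes s on both
  halves of the dual basis: n_i s is the sum over j of c_ij n_j, and z \<mapsto> F_j(z s) is the sum
  over i of F_i(z) c_ij. Multiplying by s on the left or right therefore gives the sum of all F_i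
  \<otimes> c_ij e \<otimes> n_j or F_i \<otimes> e c_ij \<otimes> n_j, and these agree since e is
  Casimir.\<close>

lemma casimir_transport:
  assumes e: "casimir B e"
  shows "casimir B' (transport e)"
  unfolding casimir_def
proof (intro conjI allI)
  have ef: "e \<in> fin_sums" using e by (simp add: casimir_def)
  have phi_ef: "fev (phi f x) e \<in> fin_sums" for f x
    by (rule fev_mem[OF add_subgroup_fsums ef phi_fin_sums])
  show "transport e \<in> fin_sums"
    unfolding transport_def by (intro add_subgroup_sum[OF add_subgroup_fsums] phi_ef)
  fix s
  define c where "c i j = F j (rm (n i) s)" for i j
  have rm_n: "rm (n i) s = (\<Sum>j<J. lm (c i j) (n j))" if "i < J" for i
    using F_n[of "rm (n i) s"] that by (simp add: c_def M_rm n_M)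
  have l: "fmap (\<lambda>(a, b). (s * a, b)) (transport e)
      - (\<Sum>j<J. \<Sum>i<J. fev (phi (F i) (n j)) (fmap (\<lambda>(a, b). (c i j * a, b)) e)) \<in> R'"
  proof -
    have "fmap (\<lambda>(a, b). (s * a, b)) (phi (F j) (n j) (a, b)) - (\<Sum>i<J. phi (F i) (n j) (c i j * a, b)) \<in> R'"
      if j: "j < J" for j a b
    proof -
      have "fmap (\<lambda>(a, b). (s * a, b)) (phi (F j) (n j) (a, b))
          = (\<Sum>k<K. fgen (s * br (F j) (lm a (m k))) (br (G k) (lm b (n j))))"
        unfolding phi_def by (simp add: fmap_sum fgen_fsums fmap_fgen)
      also have "\<dots> = (\<Sum>k<K. fgen (\<Sum>i<J. br (F i) (lm (c i j * a) (m k))) (br (G k) (lm b (n j))))"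
        using j by (intro sum.cong refl) (simp add: mult_br functional_F M_lm m_M mult_lm c_def)
      moreover have "(\<Sum>i<J. phi (F i) (n j) (c i j * a, b))
          = (\<Sum>k<K. \<Sum>i<J. fgen (br (F i) (lm (c i j * a) (m k))) (br (G k) (lm b (n j))))"
        unfolding phi_def prod.case by (rule sum.swap)
      ultimately show ?thesis
        by (simp add: add_subgroup_sum_cong[OF R'_group] tens_rel_suml[OF add_subgroup_UNIV])
    qed
    then have "fmap (\<lambda>(a, b). (s * a, b)) (fev (phi (F j) (n j)) e)
        - (\<Sum>i<J. fev (phi (F i) (n j)) (fmap (\<lambda>(a, b). (c i j * a, b)) e)) \<in> R'" if "j < J" for j
      using that
      by (simp add: fmap_fev ef phi_fin_sums fev_fmap fev_fun_sum[symmetric] case_prod_unfold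
          fev_mem_cong[OF R'_group ef])
    then show ?thesis
      unfolding transport_def
      by (subst fmap_sum) (auto intro!: phi_ef add_subgroup_sum_cong[OF R'_group])
  qed
  have r: "fmap (\<lambda>(a, b). (a, b * s)) (transport e)
      - (\<Sum>i<J. \<Sum>j<J. fev (phi (F i) (n j)) (fmap (\<lambda>(a, b). (a, b * c i j)) e)) \<in> R'"
  proof -
    have "fmap (\<lambda>(a, b). (a, b * s)) (phi (F i) (n i) (a, b)) - (\<Sum>j<J. phi (F i) (n j) (a, b * c i j)) \<in> R'"
      if i: "i < J" for i a b
    proof -
      have "br (G k) (lm b (n i)) * s = (\<Sum>j<J. br (G k) (lm (b * c i j) (n j)))" if "k < K" for k
      proof -
        have "br (G k) (lm b (n i)) * s = br (G k) (\<Sum>j<J. lm (b * c i j) (n j))"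
          using i that lm_sum[of "{..<J}" "\<lambda>j. lm (c i j) (n j)" b]
          by (simp add: br_mult functional_G M_lm n_M rm_lm rm_n mult_lm)
        also have "\<dots> = (\<Sum>j<J. br (G k) (lm (b * c i j) (n j)))"
          using that by (intro br_sum) (simp_all add: functional_G M_lm n_M)
        finally show ?thesis .
      qed
      then have "fmap (\<lambda>(a, b). (a, b * s)) (phi (F i) (n i) (a, b))
          = (\<Sum>k<K. fgen (br (F i) (lm a (m k))) (\<Sum>j<J. br (G k) (lm (b * c i j) (n j))))"
        unfolding phi_def by (simp add: fmap_sum fgen_fsums fmap_fgen)
      moreover have "(\<Sum>j<J. phi (F i) (n j) (a, b * c i j))
          = (\<Sum>k<K. \<Sum>j<J. fgen (br (F i) (lm a (m k))) (br (G k) (lm (b * c i j) (n j))))"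
        unfolding phi_def prod.case by (rule sum.swap)
      ultimately show ?thesis
        by (simp add: add_subgroup_sum_cong[OF R'_group] tens_rel_sumr[OF add_subgroup_UNIV])
    qed
    then have "fmap (\<lambda>(a, b). (a, b * s)) (fev (phi (F i) (n i)) e)
        - (\<Sum>j<J. fev (phi (F i) (n j)) (fmap (\<lambda>(a, b). (a, b * c i j)) e)) \<in> R'" if "i < J" for i
      using that
      by (simp add: fmap_fev ef phi_fin_sums fev_fmap fev_fun_sum[symmetric] case_prod_unfold
          fev_mem_cong[OF R'_group ef])
    then show ?thesis
      unfolding transport_def
      by (subst fmap_sum) (auto intro!: phi_ef add_subgroup_sum_cong[OF R'_group])
  qed
  have "fev (phi (F i) (n j)) (fmap (\<lambda>(a, b). (c i j * a, b)) e)
      - fev (phi (F i) (n j)) (fmap (\<lambda>(a, b). (a, b * c i j)) e) \<in> R'" if "i < J" "j < J" for i j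
  proof -
    have "fev (phi (F i) (n j)) (fmap (\<lambda>(a, b). (c i j * a, b)) e - fmap (\<lambda>(a, b). (a, b * c i j)) e) \<in> R'"
      using that e by (intro fev_phi_ring_rel functional_F n_M) (simp_all add: casimir_def)
    then show ?thesis by (simp add: fev_diff fmap_fin_sums ef)
  qed
  then have mid: "(\<Sum>j<J. \<Sum>i<J. fev (phi (F i) (n j)) (fmap (\<lambda>(a, b). (c i j * a, b)) e))
      - (\<Sum>i<J. \<Sum>j<J. fev (phi (F i) (n j)) (fmap (\<lambda>(a, b). (a, b * c i j)) e)) \<in> R'"
    unfolding sum.swap[of "\<lambda>i j. fev (phi (F i) (n j)) (fmap (\<lambda>(a, b). (a, b * c i j)) e)"]
    by (intro add_subgroup_sum_cong[OF R'_group]) simp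
  show "fmap (\<lambda>(a, b). (s * a, b)) (transport e) - fmap (\<lambda>(a, b). (a, b * s)) (transport e) \<in> R'"
    by (rule add_subgroup_trans[OF R'_group add_subgroup_trans[OF R'_group l mid]
          add_subgroup_sym[OF R'_group r]])
qed

text \<open>Between the two factors of the transported tensor, w meets m_k in I and acts there as v;
  the sum of the G_k(m_k) then contracts to 1. What remains is z \<mapsto> F_j(z) c n_j, summed over
  j, with c the value of e at v.\<close>

lemma rm_fev_transport:
  assumes e: "casimir B e" and v: "v \<in> centralizer B"
    and w: "\<And>x. x \<in> I \<Longrightarrow> rm x w = lm v x" and z: "z \<in> M"
  shows "rm z (fev (\<lambda>(x, y). x * w * y) (transport e)) = lm (fev (\<lambda>(x, y). x * v * y) e) z"
proof -
  have ef: "e \<in> fin_sums" using e by (simp add: casimir_def)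
  let ?c = "fev (\<lambda>(x, y). x * v * y) e"
  have inner: "(\<Sum>k<K. br (F j) (lm a (m k)) * w * br (G k) (lm b (n j))) = br (F j) (lm (a * v * b) (n j))"
    if j: "j < J" for j a b
  proof (rule rm_eqI)
    fix z assume z: "z \<in> M"
    have "rm z (\<Sum>k<K. br (F j) (lm a (m k)) * w * br (G k) (lm b (n j)))
        = (\<Sum>k<K. lm (F j z * a * v * G k (m k)) (lm b (n j)))"
      unfolding sum_rm[OF z]
      by (intro sum.cong refl)
        (simp add: z j mult_rm rm_br M_lm M_rm functional_F functional_G m_M n_M rm_lm w m_I G_lm mult.assoc)
    also have "\<dots> = rm z (br (F j) (lm (a * v * b) (n j)))"
      using z j by (subst G_generate) (simp_all add: M_lm n_M rm_br functional_F mult_lm)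
    finally show "rm z (\<Sum>k<K. br (F j) (lm a (m k)) * w * br (G k) (lm b (n j)))
        = rm z (br (F j) (lm (a * v * b) (n j)))" .
  qed
  have "fev (\<lambda>(x, y). x * w * y) (fev (phi (F j) (n j)) e) = br (F j) (lm ?c (n j))" if j: "j < J" for j
  proof -
    have "fev (\<lambda>(x, y). x * w * y) (phi (F j) (n j) (a, b)) = br (F j) (lm (a * v * b) (n j))" for a b
      unfolding inner[OF j, symmetric] phi_def by (simp add: fev_sum fgen_fsums)
    then have "fev (\<lambda>(x, y). x * w * y) (fev (phi (F j) (n j)) e)
        = fev (\<lambda>p. br (F j) (lm (case p of (x, y) \<Rightarrow> x * v * y) (n j))) e"
      by (subst fev_fev) (auto simp: phi_fin_sums intro!: arg_cong[of _ _ "\<lambda>g. fev g e"])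
    \<comment> \<open>The pairing of F_j with c n_j is additive in c, so it can be taken out of the
      evaluation.\<close>
    also have "\<dots> = br (F j) (lm ?c (n j))"
      using j by (intro additive_fev[symmetric]) (simp add: add_lm n_M br_add functional_F M_lm)
    finally show ?thesis .
  qed
  then have "fev (\<lambda>(x, y). x * w * y) (transport e) = (\<Sum>j<J. br (F j) (lm ?c (n j)))"
    unfolding transport_def
    by (subst fev_sum) (auto intro!: fev_mem[OF add_subgroup_fsums ef] phi_fin_sums)
  then have "rm z (fev (\<lambda>(x, y). x * w * y) (transport e)) = (\<Sum>j<J. lm (F j z * ?c) (n j))"
    using z by (simp add: sum_rm rm_br functional_F M_lm n_M mult_lm)
  \<comment> \<open>The value c at a Casimir element is central, so it passes to the left of
    F_j(z).\<close>
  also have "\<dots> = lm ?c (\<Sum>j<J. lm (F j z) (n j))"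
    using center_commute[OF fev_casimir_central[OF e v]]
    by (subst lm_sum) (simp_all add: M_lm n_M mult_lm[symmetric])
  finally show ?thesis by (simp add: F_n z)
qed

text \<open>The witness is the endomorphism z \<mapsto> sum of the F_j(z) v n_j. For x in I the
  coordinates F_j(x) lie in B and commute with v, which leaves v x. Commutation with
  \<open>B'\<close> is checked on I, which \<open>B'\<close> preserves.\<close>

lemma centralizer_to:
  assumes v: "v \<in> centralizer B"
  obtains w where "w \<in> centralizer B'" "\<And>x. x \<in> I \<Longrightarrow> rm x w = lm v x"
proof
  define w where "w = (\<Sum>j<J. br (F j) (lm v (n j)))"
  show w: "rm x w = lm v x" if x: "x \<in> I" for x
  proof -
    have "F j x * v = v * F j x" if "j < J" for j
      using centralizer_commute[OF v F_I[OF that x]] .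
    then have "rm x w = (\<Sum>j<J. lm v (lm (F j x) (n j)))"
      unfolding w_def sum_rm[OF I_M[OF x]]
      by (intro sum.cong refl) (simp add: rm_br functional_F M_lm n_M I_M x mult_lm[symmetric])
    also have "\<dots> = lm v x"
      by (subst lm_sum[symmetric]) (simp_all add: M_lm n_M F_n I_M x)
    finally show ?thesis .
  qed
  have "b * w = w * b" if b: "b \<in> B'" for b
    by (rule rm_eqI_I) (simp add: mult_rm I_M I_rm b w rm_lm)
  then show "w \<in> centralizer B'" by (simp add: centralizer_def)
qed

text \<open>For x in I the map z \<mapsto> G_k(z) x is right multiplication by some b' in
  \<open>B'\<close>, with which w commutes: G_k(m_k w) x = m_k w b' = m_k b' w = (G_k(m_k) x) w.
  Summing over k explains the choice of \<open>v\<close>.\<close>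

lemma centralizer_from:
  assumes w: "w \<in> centralizer B'"
  obtains v where "v \<in> centralizer B" "\<And>x. x \<in> I \<Longrightarrow> rm x w = lm v x"
proof
  define v where "v = (\<Sum>k<K. G k (rm (m k) w))"
  show v: "rm x w = lm v x" if x: "x \<in> I" for x
  proof -
    have "lm (G k (rm (m k) w)) x = rm (lm (G k (m k)) x) w" if k: "k < K" for k
    proof -
      obtain b' where b': "b' \<in> B'" "\<And>z. z \<in> M \<Longrightarrow> rm z b' = lm (G k z * 1) x"
        using G_B'[OF k one_B x] by blast
      have "lm (G k (rm (m k) w)) x = rm (m k) (w * b')"
        using k by (simp add: mult_rm m_M M_rm b')
      also have "\<dots> = rm (m k) (b' * w)"
        using centralizer_commute[OF w b'(1)] by simp
      also have "\<dots> = rm (lm (G k (m k)) x) w"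
        using k by (simp add: mult_rm m_M b')
      finally show ?thesis .
    qed
    then have "lm v x = (\<Sum>k<K. rm (lm (G k (m k)) x) w)"
      by (simp add: v_def sum_lm I_M x)
    also have "\<dots> = rm (\<Sum>k<K. lm (G k (m k)) x) w"
      by (rule rm_sum[symmetric]) (simp add: M_lm I_M x)
    also have "\<dots> = rm x w"
      using G_generate[of x 1] by (simp add: I_M x one_lm)
    finally show ?thesis by simp
  qed
  have "b * v = v * b" if b: "b \<in> B" for b
  proof -
    have "lm (b * v) x = lm (v * b) x" if x: "x \<in> I" for x
    proof -
      have "lm (b * v) x = lm b (rm x w)"
        by (simp add: mult_lm I_M x v)
      also have "\<dots> = rm (lm b x) w"
        by (simp add: rm_lm I_M x)
      also have "\<dots> = lm (v * b) x"
        by (simp add: v I_lm b mult_lm I_M x)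
      finally show ?thesis .
    qed
    then have "(\<Sum>k<K. G k (lm (b * v) (m k))) = (\<Sum>k<K. G k (lm (v * b) (m k)))"
      using m_I by simp
    \<comment> \<open>An element of A can be read off from its action on the m_k, so agreement on I
      gives b v = v b.\<close>
    moreover have "(\<Sum>k<K. G k (lm a (m k))) = a" for a
      using G_m by (simp add: G_lm m_M sum_distrib_left[symmetric])
    ultimately show ?thesis by simp
  qed
  then show "v \<in> centralizer B" by (simp add: centralizer_def)
qed

text \<open>Let u in V act on I as u' does. On I each \<open>w i\<close> acts as \<open>v i\<close>,
  and the transported coordinate of u' acts as the central coordinate of u; so the new dual basis
  identity for u' is the old one for u, read on I.\<close>

lemma strongly_separable_transfer:
  assumes "strongly_separable B"
  shows "strongly_separable B'"
proof -
  obtain r :: nat and v e where v: "\<And>i. i < r \<Longrightarrow> v i \<in> centralizer B"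
    and e: "\<And>i. i < r \<Longrightarrow> casimir B (e i)"
    and ve: "\<And>u. u \<in> centralizer B \<Longrightarrow> (\<Sum>i<r. v i * mu_map (centralizer B) (e i) u) = u"
    using assms by (rule strongly_separableD) blast
  have "\<forall>i. \<exists>w. i < r \<longrightarrow> w \<in> centralizer B' \<and> (\<forall>x\<in>I. rm x w = lm (v i) x)"
    using centralizer_to[OF v] by metis
  then obtain w where w: "\<And>i. i < r \<Longrightarrow> w i \<in> centralizer B'"
    and wv: "\<And>i x. i < r \<Longrightarrow> x \<in> I \<Longrightarrow> rm x (w i) = lm (v i) x"
    by metis
  show ?thesis
  proof (rule strongly_separableI[of r w B' "\<lambda>i. transport (e i)"])
    fix u' assume "u' \<in> centralizer B'"
    then obtain u where u: "u \<in> centralizer B" and uu: "\<And>x. x \<in> I \<Longrightarrow> rm x u' = lm u x"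
      by (rule centralizer_from) blast
    let ?c = "\<lambda>i. fev (\<lambda>(x, y). x * u * y) (e i)"
    show "(\<Sum>i<r. w i * fev (\<lambda>(x, y). x * u' * y) (transport (e i))) = u'"
    proof (rule rm_eqI_I)
      fix x assume x: "x \<in> I"
      have "rm x (\<Sum>i<r. w i * fev (\<lambda>(x, y). x * u' * y) (transport (e i)))
          = (\<Sum>i<r. lm (?c i) (lm (v i) x))"
        unfolding sum_rm[OF I_M[OF x]]
        by (intro sum.cong refl)
          (simp add: mult_rm I_M x wv M_lm rm_fev_transport[OF e u uu])
      also have "\<dots> = (\<Sum>i<r. lm (v i * ?c i) x)"
        using center_commute[OF fev_casimir_central[OF e u]]
        by (intro sum.cong refl) (simp add: mult_lm[symmetric] I_M x)
      also have "\<dots> = lm u x"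
        using ve[OF u] u by (simp add: mu_map_eq sum_lm[symmetric] I_M x)
      finally show "rm x (\<Sum>i<r. w i * fev (\<lambda>(x, y). x * u' * y) (transport (e i))) = rm x u'"
        using uu[OF x] by simp
    qed
  qed (use w casimir_transport[OF e] in auto)
qed

end

section \<open>The bimodules of a Morita equivalence\<close>

text \<open>Linear functionals over a subset R of the ring: values must lie in R itself, unlike for
  \<open>functional\<close>, where the scalars are the whole type.\<close>

definition lfun :: "'r::ring_1 set \<Rightarrow> 'n::ab_group_add set \<Rightarrow> ('r \<Rightarrow> 'n \<Rightarrow> 'n) \<Rightarrow> ('n \<Rightarrow> 'r) \<Rightarrow> bool" where
  "lfun R X l f \<longleftrightarrow> (\<forall>x\<in>X. f x \<in> R) \<and> (\<forall>x\<in>X. \<forall>y\<in>X. f (x + y) = f x + f y)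
     \<and> (\<forall>a\<in>R. \<forall>x\<in>X. f (l a x) = a * f x)"

lemma bimodD:
  assumes "bimod R S X l r"
  shows "add_subgroup X"
    and "\<And>a x. a \<in> R \<Longrightarrow> x \<in> X \<Longrightarrow> l a x \<in> X"
    and "\<And>s x. s \<in> S \<Longrightarrow> x \<in> X \<Longrightarrow> r x s \<in> X"
    and "\<And>a x y. a \<in> R \<Longrightarrow> x \<in> X \<Longrightarrow> y \<in> X \<Longrightarrow> l a (x + y) = l a x + l a y"
    and "\<And>a b x. a \<in> R \<Longrightarrow> b \<in> R \<Longrightarrow> x \<in> X \<Longrightarrow> l (a + b) x = l a x + l b x"
    and "\<And>a b x. a \<in> R \<Longrightarrow> b \<in> R \<Longrightarrow> x \<in> X \<Longrightarrow> l (a * b) x = l a (l b x)"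
    and "\<And>x. x \<in> X \<Longrightarrow> l 1 x = x"
    and "\<And>s x y. s \<in> S \<Longrightarrow> x \<in> X \<Longrightarrow> y \<in> X \<Longrightarrow> r (x + y) s = r x s + r y s"
    and "\<And>a s x. a \<in> R \<Longrightarrow> s \<in> S \<Longrightarrow> x \<in> X \<Longrightarrow> r (l a x) s = l a (r x s)"
  using assms by (simp_all add: bimod_def add_subgroup_def)

lemma subringD:
  assumes "subring B"
  shows "add_subgroup B" "1 \<in> B" "x \<in> B \<Longrightarrow> y \<in> B \<Longrightarrow> x * y \<in> B"
proof -
  have "1 - 1 \<in> B" using assms unfolding subring_def by blast
  then show "add_subgroup B" using assms by (simp add: subring_def add_subgroup_def)
qed (use assms in \<open>auto simp: subring_def\<close>)

text \<open>N is a retract of a free B-module: the f_j are the coordinates of the embedding, the n_j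
  the images of the unit vectors under the retraction.\<close>

lemma projective_dual_basis:
  fixes B :: "'a::ring_1 set" and N :: "'n::ab_group_add set"
  assumes B: "subring B" and dvd: "lmod_dvd B N ln B (*)"
  obtains J :: nat and f n where "\<forall>j<J. lfun B N ln (f j)" "\<forall>j<J. n j \<in> N"
    "\<forall>x\<in>N. (\<Sum>j<J. ln (f j x) (n j)) = x"
proof -
  note Bg = subringD(1)[OF B]
  from dvd obtain J p q where
    "\<forall>x\<in>N. p x \<in> free_mod B J" and "\<forall>c\<in>free_mod B J. q c \<in> N"
    and "\<forall>x\<in>N. \<forall>x'\<in>N. p (x + x') = (\<lambda>i. p x i + p x' i)"
    and "\<forall>a\<in>B. \<forall>x\<in>N. p (ln a x) = (\<lambda>i. a * p x i)"
    and "\<forall>c\<in>free_mod B J. \<forall>d\<in>free_mod B J. q (\<lambda>i. c i + d i) = q c + q d"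
    and "\<forall>a\<in>B. \<forall>c\<in>free_mod B J. q (\<lambda>i. a * c i) = ln a (q c)"
    and "\<forall>x\<in>N. q (p x) = x"
    unfolding lmod_dvd_def by (elim exE conjE) (rule that)
  note p = this(1)[rule_format] and q = this(2)[rule_format] and p_add = this(3)[rule_format]
    and p_mult = this(4)[rule_format] and q_add = this(5)[rule_format]
    and q_mult = this(6)[rule_format] and qp = this(7)[rule_format]
  define u where "u j = (\<lambda>i. if i = j then 1 else 0 :: 'a)" for j :: nat
  have pB: "p x j \<in> B" if "x \<in> N" for x j
    using p[OF that] add_subgroup_zero[OF Bg] by (cases "j < J") (auto simp: free_mod_def)
  have u: "u j \<in> free_mod B J" if "j < J" for j
    using that subringD(2)[OF B] add_subgroup_zero[OF Bg] by (auto simp: u_def free_mod_def)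
  show ?thesis
  proof (rule that[of J "\<lambda>j x. p x j" "\<lambda>j. q (u j)"])
    show "\<forall>j<J. lfun B N ln (\<lambda>x. p x j)"
      by (simp add: lfun_def pB p_add p_mult)
    show "\<forall>j<J. q (u j) \<in> N"
      by (simp add: q u)
    show "\<forall>x\<in>N. (\<Sum>j<J. ln (p x j) (q (u j))) = x"
    proof
      fix x assume x: "x \<in> N"
      have "p x = (\<Sum>j<J. (\<lambda>i. p x j * u j i))"
      proof
        fix i
        show "p x i = (\<Sum>j<J. (\<lambda>i. p x j * u j i)) i"
          using p[OF x] by (simp add: sum_fun_apply u_def free_mod_def if_distrib[of "\<lambda>a. _ * a"]
              sum.delta cong: if_cong)
      qed
      then have "x = q (\<Sum>j<J. (\<lambda>i. p x j * u j i))"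
        using qp[OF x] by simp
      also have "\<dots> = (\<Sum>j<J. q (\<lambda>i. p x j * u j i))"
      proof (rule additive_sum[OF add_subgroup_free_mod[OF Bg]])
        show "q (c + d) = q c + q d" if "c \<in> free_mod B J" "d \<in> free_mod B J" for c d
          using q_add[OF that] by (simp add: plus_fun_def)
        show "(\<lambda>i. p x j * u j i) \<in> free_mod B J" if "j \<in> {..<J}" for j
          using that pB[OF x] add_subgroup_zero[OF Bg] by (auto simp: u_def free_mod_def)
      qed
      also have "\<dots> = (\<Sum>j<J. ln (p x j) (q (u j)))"
        by (intro sum.cong refl) (simp add: q_mult u pB x)
      finally show "(\<Sum>j<J. ln (p x j) (q (u j))) = x" by simp
    qed
  qed
qed

text \<open>B is a retract of a finite power of N: the m_k are the components of the image of 1, and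
  g_k is the retraction restricted to the k-th copy of N.\<close>

lemma generator_trace:
  fixes B :: "'a::ring_1 set" and N :: "'n::ab_group_add set"
  assumes B: "subring B" and N: "bimod B S N ln rn" and dvd: "lmod_dvd B B (*) N ln"
  obtains K :: nat and g m where "\<forall>k<K. lfun B N ln (g k)" "\<forall>k<K. m k \<in> N"
    "(\<Sum>k<K. g k (m k)) = 1"
proof -
  note Ng = bimodD(1)[OF N]
  have N0: "0 \<in> N" by (rule add_subgroup_zero[OF Ng])
  from dvd obtain K p q where
    "\<forall>x\<in>B. p x \<in> free_mod N K" and "\<forall>c\<in>free_mod N K. q c \<in> B"
    and "\<forall>c\<in>free_mod N K. \<forall>d\<in>free_mod N K. q (\<lambda>i. c i + d i) = q c + q d"
    and "\<forall>a\<in>B. \<forall>c\<in>free_mod N K. q (\<lambda>i. ln a (c i)) = a * q c"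
    and "\<forall>x\<in>B. q (p x) = x"
    unfolding lmod_dvd_def by (elim exE conjE) (rule that)
  note p = this(1)[rule_format] and q = this(2)[rule_format] and q_add = this(3)[rule_format]
    and q_mult = this(4)[rule_format] and qp = this(5)[rule_format]
  define u where "u k y = (\<lambda>i. if i = k then y else 0)" for k :: nat and y :: 'n
  note p1 = p[OF subringD(2)[OF B]]
  have ln0: "ln a 0 = 0" if "a \<in> B" for a
    using bimodD(4)[OF N that N0 N0] by simp
  have u: "u k y \<in> free_mod N K" if "k < K" "y \<in> N" for k y
    using that N0 by (auto simp: u_def free_mod_def)
  have u_add: "u k (x + y) = (\<lambda>i. u k x i + u k y i)" for k x y
    by (auto simp: u_def)
  have u_ln: "u k (ln a y) = (\<lambda>i. ln a (u k y i))" if "a \<in> B" for k a y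
    by (auto simp: u_def ln0 that)
  show ?thesis
  proof (rule that[of K "\<lambda>k y. q (u k y)" "p 1"])
    show "\<forall>k<K. lfun B N ln (\<lambda>y. q (u k y))"
      by (simp add: lfun_def q u u_add q_add u_ln q_mult)
    show "\<forall>k<K. p 1 k \<in> N"
      using p1 by (simp add: free_mod_def)
    have "p 1 = (\<Sum>k<K. u k (p 1 k))"
    proof
      fix i
      show "p 1 i = (\<Sum>k<K. u k (p 1 k)) i"
        using p1 by (simp add: sum_fun_apply u_def free_mod_def sum.delta)
    qed
    then have "1 = q (\<Sum>k<K. u k (p 1 k))"
      using qp[OF subringD(2)[OF B]] by simp
    also have "\<dots> = (\<Sum>k<K. q (u k (p 1 k)))"
    proof (rule additive_sum[OF add_subgroup_free_mod[OF Ng]])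
      show "q (c + d) = q c + q d" if "c \<in> free_mod N K" "d \<in> free_mod N K" for c d
        using q_add[OF that] by (simp add: plus_fun_def)
      show "u k (p 1 k) \<in> free_mod N K" if "k \<in> {..<K}" for k
        using that p1 by (intro u) (auto simp: free_mod_def)
    qed
    finally show "(\<Sum>k<K. q (u k (p 1 k))) = 1" by simp
  qed
qed

text \<open>It remains to produce the data of \<open>morita_ctx\<close>. Functionals on N extend to
  M = A \<otimes> N over B by a \<otimes> x \<mapsto> a f(x), and with them the dual basis and the
  trace identity of N become those of M.\<close>

theorem theorem3p4:
  fixes B :: "'a::ring_1 set" and B' :: "'b::ring_1 set"
    and M :: "'m::ab_group_add set" and lm :: "'a \<Rightarrow> 'm \<Rightarrow> 'm" and rm :: "'m \<Rightarrow> 'b \<Rightarrow> 'm"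
    and N :: "'n::ab_group_add set" and ln :: "'a \<Rightarrow> 'n \<Rightarrow> 'n" and rn :: "'n \<Rightarrow> 'b \<Rightarrow> 'n"
  assumes "subring B" and "subring B'"
    and "strongly_separable B"
    and "morita_equiv_via B B' M lm rm N ln rn"
  shows "strongly_separable B'"
proof -
  let ?F = "fsums (UNIV :: 'a set) N" and ?R = "tens_rel (UNIV :: 'a set) N B (*) ln"
  note B = assms(1)
  have "morita_module UNIV UNIV M lm rm" and "morita_module B B' N ln rn"
    using assms(4) by (simp_all add: morita_equiv_via_def)
  then have M: "bimod UNIV UNIV M lm rm" and N: "bimod B B' N ln rn"
    and projN: "lmod_dvd B N ln B (*)" and genN: "lmod_dvd B B (*) N ln"
    and endoM: "\<And>\<phi>. \<lbrakk>\<forall>x\<in>M. \<phi> x \<in> M; \<forall>x\<in>M. \<forall>y\<in>M. \<phi> (x + y) = \<phi> x + \<phi> y;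
        \<forall>a. \<forall>x\<in>M. \<phi> (lm a x) = lm a (\<phi> x)\<rbrakk> \<Longrightarrow> \<exists>!s. \<forall>x\<in>M. \<phi> x = rm x s"
    and endoN: "\<And>\<phi>. \<lbrakk>\<forall>x\<in>N. \<phi> x \<in> N; \<forall>x\<in>N. \<forall>y\<in>N. \<phi> (x + y) = \<phi> x + \<phi> y;
        \<forall>a\<in>B. \<forall>x\<in>N. \<phi> (ln a x) = ln a (\<phi> x)\<rbrakk> \<Longrightarrow> \<exists>s. s \<in> B' \<and> (\<forall>x\<in>N. \<phi> x = rn x s)"
    unfolding morita_module_def by (simp, blast, simp, simp, simp, blast)
  note Mg = bimodD(1)[OF M]
    and lm_add = bimodD(4)[OF M UNIV_I] and add_lm = bimodD(5)[OF M UNIV_I UNIV_I]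
    and mult_lm = bimodD(6)[OF M UNIV_I UNIV_I]
    and rm_add = bimodD(8)[OF M UNIV_I] and rm_lm = bimodD(9)[OF M UNIV_I UNIV_I]
  note Ng = bimodD(1)[OF N] and N_ln = bimodD(2)[OF N] and N_rn = bimodD(3)[OF N]
    and add_ln = bimodD(5)[OF N] and mult_ln = bimodD(6)[OF N]
  from assms(4) obtain \<theta> \<psi> where \<theta>M: "\<forall>\<phi>\<in>?F. \<theta> \<phi> \<in> M"
    and \<theta>_add: "\<forall>\<phi>\<in>?F. \<forall>\<phi>'\<in>?F. \<theta> (\<lambda>p. \<phi> p + \<phi>' p) = \<theta> \<phi> + \<theta> \<phi>'"
    and \<theta>_rel: "\<forall>\<rho>\<in>?R. \<theta> \<rho> = 0"
    and \<theta>_lm: "\<forall>a. \<forall>\<phi>\<in>?F. \<theta> (fmap (\<lambda>(x, y). (a * x, y)) \<phi>) = lm a (\<theta> \<phi>)"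
    and \<theta>_rm: "\<forall>b\<in>B'. \<forall>\<phi>\<in>?F. \<theta> (fmap (\<lambda>(x, y). (x, rn y b)) \<phi>) = rm (\<theta> \<phi>) b"
    and \<psi>: "\<forall>m\<in>M. \<psi> m \<in> ?F \<and> \<theta> (\<psi> m) = m"
    and \<psi>\<theta>: "\<forall>\<phi>\<in>?F. (\<lambda>p. \<psi> (\<theta> \<phi>) p - \<phi> p) \<in> ?R"
    unfolding morita_equiv_via_def Let_def by (elim conjE exE) (rule that)
  note F_group = add_subgroup_fsums[of "UNIV :: 'a set" N]
  have \<theta>_plus: "\<theta> (\<phi> + \<phi>') = \<theta> \<phi> + \<theta> \<phi>'" if "\<phi> \<in> ?F" "\<phi>' \<in> ?F" for \<phi> \<phi>'
    using \<theta>_add that by (simp add: plus_fun_def)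
  have \<theta>_minus: "\<theta> (\<phi> - \<phi>') = \<theta> \<phi> - \<theta> \<phi>'" if "\<phi> \<in> ?F" "\<phi>' \<in> ?F" for \<phi> \<phi>'
    using F_group \<theta>_plus that by (rule additive_diff)
  have \<theta>_eq: "\<theta> \<phi> = \<theta> \<phi>'" if "\<phi> \<in> ?F" "\<phi>' \<in> ?F" "\<phi> - \<phi>' \<in> ?R" for \<phi> \<phi>'
    using \<theta>_minus[OF that(1,2)] \<theta>_rel that(3) by simp
  have \<theta>_0: "\<theta> 0 = 0"
    using \<theta>_rel add_subgroup_zero[OF add_subgroup_tens_rel] by blast

  \<comment> \<open>The canonical map N -> A \<otimes> N, x \<mapsto> 1 \<otimes> x, seen in M; its
    image is the set I of the context.\<close>
  define \<iota> where "\<iota> x = \<theta> (fgen 1 x)" for x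
  have gen: "fgen a x \<in> ?F" if "x \<in> N" for a x
    using that by (simp add: fgen_fsums)
  have \<iota>_M: "\<iota> x \<in> M" if "x \<in> N" for x
    using \<theta>M gen[OF that] by (simp add: \<iota>_def)
  have \<theta>_gen: "\<theta> (fgen a x) = lm a (\<iota> x)" if "x \<in> N" for a x
    using \<theta>_lm[rule_format, OF gen[OF that], of a 1] by (simp add: fmap_fgen \<iota>_def)
  have \<iota>_add: "\<iota> (x + y) = \<iota> x + \<iota> y" if "x \<in> N" "y \<in> N" for x y
  proof -
    have "\<theta> (fgen 1 (x + y)) = \<theta> (fgen 1 x + fgen 1 y)"
      using that by (intro \<theta>_eq tens_rel_addr gen add_subgroup_add[OF F_group] add_subgroup_add[OF Ng]) auto
    then show ?thesis using that by (simp add: \<iota>_def \<theta>_plus gen)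
  qed
  have \<iota>_ln: "\<iota> (ln b x) = lm b (\<iota> x)" if "b \<in> B" "x \<in> N" for b x
  proof -
    have "\<theta> (fgen (1 * b) x) = \<theta> (fgen 1 (ln b x))"
      using that by (intro \<theta>_eq tens_rel_bal gen N_ln) auto
    then show ?thesis using that by (simp add: \<theta>_gen) (simp add: \<iota>_def)
  qed
  have \<iota>_rn: "\<iota> (rn x b) = rm (\<iota> x) b" if "b \<in> B'" "x \<in> N" for b x
    using \<theta>_rm[rule_format, OF that(1) gen[OF that(2)], of 1] by (simp add: fmap_fgen \<iota>_def)
  have \<iota>_sum: "\<iota> (\<Sum>i\<in>S. x i) = (\<Sum>i\<in>S. \<iota> (x i))" if "\<And>i. i \<in> S \<Longrightarrow> x i \<in> N" for S and x :: "nat \<Rightarrow> 'n"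
    using Ng \<iota>_add that by (rule additive_sum)
  have lm_0: "lm 0 x = 0" if "x \<in> M" for x
    using add_lm[OF that, of 0 0] by simp
  have lm_diff: "lm (c - d) x = lm c x - lm d x" if "x \<in> M" for c d x
    using add_lm[OF that, of "c - d" d] by simp
  have rm_0: "rm 0 s = 0" for s
    using rm_add[OF add_subgroup_zero[OF Mg] add_subgroup_zero[OF Mg], of s] by simp
  have rm_diff: "rm (x - y) s = rm x s - rm y s" if "x \<in> M" "y \<in> M" for x y s
    using rm_add[OF add_subgroup_diff[OF Mg that] that(2), of s] by simp

  define ev where "ev f = fev (\<lambda>(a, y). a * f y)" for f :: "'n \<Rightarrow> 'a"
  \<comment> \<open>The extended functional, computed on the representative chosen by
    \<open>\<psi>\<close>.\<close>
  define ext where "ext f z = ev f (\<psi> z)" for f :: "'n \<Rightarrow> 'a" and z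
  have ext_\<theta>: "ext f (\<theta> \<phi>) = ev f \<phi>" if f: "lfun B N ln f" and \<phi>: "\<phi> \<in> ?F" for f \<phi>
  proof -
    \<comment> \<open>Independence of the representative: two formal sums for the same element of M
      differ by a relation, and \<open>ev f\<close> kills relations.\<close>
    have "ev f (\<lambda>p. \<psi> (\<theta> \<phi>) p - \<phi> p) \<in> {0}"
      unfolding ev_def
      by (rule fev_tens_rel[OF add_subgroup_0 _ _ _ \<psi>\<theta>[rule_format, OF \<phi>]])
        (use f in \<open>auto simp: lfun_def algebra_simps\<close>)
    moreover have "\<psi> (\<theta> \<phi>) \<in> ?F" using \<theta>M \<psi> \<phi> by blast
    ultimately show ?thesis
      using \<phi> by (simp add: ext_def ev_def fev_diff' fsums_fin_sums)
  qed
  have ext_add: "ext f (x + y) = ext f x + ext f y" if f: "lfun B N ln f" and "x \<in> M" "y \<in> M" for f x y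
  proof -
    have *: "\<psi> x \<in> ?F" "\<psi> y \<in> ?F" "\<theta> (\<psi> x) = x" "\<theta> (\<psi> y) = y" using \<psi> that by auto
    then have "ext f (x + y) = ext f (\<theta> (\<psi> x + \<psi> y))" by (simp add: \<theta>_plus)
    also have "\<dots> = ext f x + ext f y"
      using * by (subst ext_\<theta>[OF f])
        (simp_all add: add_subgroup_add[OF F_group] ext_def ev_def fev_add fsums_fin_sums)
    finally show ?thesis .
  qed
  have ext_lm: "ext f (lm a x) = a * ext f x" if f: "lfun B N ln f" and "x \<in> M" for f a x
  proof -
    have *: "\<psi> x \<in> ?F" "\<theta> (\<psi> x) = x" using \<psi> that by auto
    then have "ext f (lm a x) = ext f (\<theta> (fmap (\<lambda>(x, y). (a * x, y)) (\<psi> x)))" by (simp add: \<theta>_lm)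
    also have "\<dots> = ev f (fmap (\<lambda>(x, y). (a * x, y)) (\<psi> x))"
      by (rule ext_\<theta>[OF f]) (rule fmap_fsums[OF *(1)], simp)
    also have "\<dots> = a * ext f x"
      using * by (simp add: ext_def ev_def fev_fmap fsums_fin_sums fev_mult_left[symmetric]
          case_prod_unfold mult.assoc)
    finally show ?thesis .
  qed
  have ext_\<iota>: "ext f (\<iota> x) = f x" if "lfun B N ln f" "x \<in> N" for f x
    using ext_\<theta>[OF that(1) gen[OF that(2)]] by (simp add: \<iota>_def ev_def)

  obtain J :: nat and f n where f: "\<forall>j<J. lfun B N ln (f j)" and n: "\<forall>j<J. n j \<in> N"
    and fn: "\<forall>x\<in>N. (\<Sum>j<J. ln (f j x) (n j)) = x"
    using projective_dual_basis[OF B projN] by blast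
  note f = f[rule_format] and n = n[rule_format] and fn = fn[rule_format]
  obtain K :: nat and g m where g: "\<forall>k<K. lfun B N ln (g k)" and m: "\<forall>k<K. m k \<in> N"
    and gm: "(\<Sum>k<K. g k (m k)) = 1"
    using generator_trace[OF B N genN] by blast
  note g = g[rule_format] and m = m[rule_format]
  \<comment> \<open>Stated for formal sums rather than elements of M, so that only generators a
    \<otimes> x must be treated; there x is expanded in the dual basis of N.\<close>
  have basis: "\<theta> \<phi> = (\<Sum>j<J. lm (ev (f j) \<phi>) (\<iota> (n j)))" if "\<phi> \<in> ?F" for \<phi>
    using that
  proof (induction rule: fsums_induct)
    case zero
    show "\<theta> 0 = (\<Sum>j<J. lm (ev (f j) 0) (\<iota> (n j)))"
      by (simp add: \<theta>_0 ev_def lm_0 \<iota>_M n)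
  next
    case (gen a x)
    have fB: "f j x \<in> B" if "j < J" for j
      using f[OF that] gen by (simp add: lfun_def)
    have "lm a (\<iota> x) = lm a (\<Sum>j<J. \<iota> (ln (f j x) (n j)))"
      using \<iota>_sum[of "{..<J}" "\<lambda>j. ln (f j x) (n j)"] fn[OF gen(2)] by (simp add: N_ln fB n)
    also have "\<dots> = (\<Sum>j<J. lm a (\<iota> (ln (f j x) (n j))))"
      by (rule additive_sum[OF Mg lm_add]) (simp_all add: \<iota>_M N_ln fB n)
    also have "\<dots> = (\<Sum>j<J. lm (a * f j x) (\<iota> (n j)))"
      by (intro sum.cong refl) (simp add: \<iota>_ln fB n mult_lm \<iota>_M)
    finally show ?case using gen by (simp add: \<theta>_gen ev_def)
  next
    case (diff \<phi> \<psi>)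
    then show "\<theta> (\<phi> - \<psi>) = (\<Sum>j<J. lm (ev (f j) (\<phi> - \<psi>)) (\<iota> (n j)))"
      by (simp add: \<theta>_minus ev_def fev_diff fsums_fin_sums lm_diff \<iota>_M n sum_subtractf)
  qed

  interpret morita_ctx B B' M lm rm "\<iota> ` N" J "\<lambda>j. ext (f j)" "\<lambda>j. \<iota> (n j)"
    K "\<lambda>k. ext (g k)" "\<lambda>k. \<iota> (m k)"
  proof
    show "1 \<in> B" by (rule subringD(2)[OF B])
    show "bimod UNIV UNIV M lm rm" by (rule M)
    show "\<exists>!s. \<forall>x\<in>M. \<phi> x = rm x s" if "\<forall>x\<in>M. \<phi> x \<in> M" "\<forall>x\<in>M. \<forall>y\<in>M. \<phi> (x + y) = \<phi> x + \<phi> y"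
      "\<forall>a. \<forall>x\<in>M. \<phi> (lm a x) = lm a (\<phi> x)" for \<phi>
      using that by (rule endoM)
    show "x \<in> M" if "x \<in> \<iota> ` N" for x
      using that \<iota>_M by auto
    show "lm b x \<in> \<iota> ` N" if "b \<in> B" "x \<in> \<iota> ` N" for b x
      using that by (auto simp: \<iota>_ln[symmetric] N_ln)
    show "rm x b \<in> \<iota> ` N" if "b \<in> B'" "x \<in> \<iota> ` N" for b x
      using that by (auto simp: \<iota>_rn[symmetric] N_rn)
    show "ext (f j) x \<in> B" if "j < J" "x \<in> \<iota> ` N" for j x
      using that f by (auto simp: ext_\<iota> lfun_def)
    show "(\<Sum>j<J. lm (ext (f j) x) (\<iota> (n j))) = x" if "x \<in> M" for x
      using basis[of "\<psi> x"] \<psi> that by (simp add: ext_def)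
    show "(\<Sum>k<K. ext (g k) (\<iota> (m k))) = 1"
      using gm by (simp add: ext_\<iota> g m)
    show "\<exists>b'\<in>B'. \<forall>z\<in>M. rm z b' = lm (ext (g k) z * b) x"
      if k: "k < K" and b: "b \<in> B" and "x \<in> \<iota> ` N" for k b x
    proof -
      from that(3) obtain y where y: "y \<in> N" "x = \<iota> y" by auto
      have gB: "g k z \<in> B" if "z \<in> N" for z
        using g[OF k] that by (simp add: lfun_def)
      \<comment> \<open>The map z \<mapsto> g_k(z) b y is a B-endomorphism of N, hence given by some
        s in \<open>B'\<close>; this is where s is found in \<open>B'\<close> and not merely in
        \<open>A'\<close>.\<close>
      have "\<exists>s. s \<in> B' \<and> (\<forall>z\<in>N. ln (g k z * b) y = rn z s)"
      proof (rule endoN)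
        show "\<forall>z\<in>N. ln (g k z * b) y \<in> N"
          by (simp add: N_ln gB b y(1) subringD(3)[OF B])
        show "\<forall>z\<in>N. \<forall>z'\<in>N. ln (g k (z + z') * b) y = ln (g k z * b) y + ln (g k z' * b) y"
          using g[OF k] by (simp add: lfun_def distrib_right add_ln b y(1) subringD(3)[OF B])
        show "\<forall>a\<in>B. \<forall>z\<in>N. ln (g k (ln a z) * b) y = ln a (ln (g k z * b) y)"
          using g[OF k] by (simp add: lfun_def mult.assoc mult_ln[symmetric] b y(1) subringD(3)[OF B])
      qed
      then obtain s where s: "s \<in> B'" "\<And>z. z \<in> N \<Longrightarrow> rn z s = ln (g k z * b) y" by metis
      \<comment> \<open>Both sides are additive and A-linear on M, so the equality on N extends from
        the generators.\<close>
      have "rm (\<theta> \<phi>) s = lm (ev (g k) \<phi> * b) (\<iota> y)" if "\<phi> \<in> ?F" for \<phi>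
        using that
      proof (induction rule: fsums_induct)
        case zero
        show "rm (\<theta> 0) s = lm (ev (g k) 0 * b) (\<iota> y)"
          by (simp add: \<theta>_0 ev_def lm_0 rm_0 \<iota>_M y)
      next
        case (gen a z)
        then have "rm (\<theta> (fgen a z)) s = lm a (\<iota> (rn z s))"
          by (simp add: \<theta>_gen rm_lm \<iota>_M \<iota>_rn s(1))
        also have "\<dots> = lm (a * (g k z * b)) (\<iota> y)"
          using gen by (simp add: s(2) \<iota>_ln gB b y(1) subringD(3)[OF B] mult_lm \<iota>_M)
        finally show ?case by (simp add: ev_def mult.assoc)
      next
        case (diff \<phi> \<psi>)
        then show "rm (\<theta> (\<phi> - \<psi>)) s = lm (ev (g k) (\<phi> - \<psi>) * b) (\<iota> y)"
          using \<theta>M by (simp add: \<theta>_minus rm_diff ev_def fev_diff fsums_fin_sums left_diff_distrib lm_diff \<iota>_M y)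
      qed
      then have "rm z s = lm (ext (g k) z * b) x" if "z \<in> M" for z
        using \<psi> that y(2) by (metis ext_def)
      then show ?thesis using s(1) by blast
    qed
  qed (use ext_add[OF f] ext_lm[OF f] ext_add[OF g] ext_lm[OF g] n m in auto)

  show ?thesis
    by (rule strongly_separable_transfer[OF assms(3)])
qed

end
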